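(* Let $\mathcal S$ be a complete separable metric space, $\mu$ a boundedly finite nonatomic Borel measure on $\mathcal S$, $a>0$ and $c>0$. For $k\in\mathbb N$ let $N_k$ be a generalized Waring process on $\mathcal S$ with parameters $a$, $\rho=ck$, $k$ and parameter measure $\mu$. Then, as $k\to\infty$, $N_k$ converges weakly (in distribution, as point processes) to the negative binomial process $N$ with parameters $a$ and $c$; in particular $P\{N_k(A)=0\}\to \left(\frac{c}{c+\mu(A)}\right)^{a}=P\{N(A)=0\}$ for every bounded Borel set $A$.
   Context: For $x>0$, $\beta\ge0$ write $x_{(\beta)}=\Gamma(x+\beta)/\Gamma(x)$, with $0_{(0)}=1$ and $0_{(n)}=0$ for integers $n\ge1$. For $a,\rho>0$ and $k_1,\dots,k_s\ge 0$, $\mathrm{MGWD}(a;k_1,\dots,k_s;\rho)$ denotes the law on $\{0,1,2,\dots\}^s$ with $P(X_i=x_i,\ i=1,\dots,s)=\frac{\rho_{(\sum_i k_i)}\,a_{(\sum_i x_i)}}{(\rho+a)_{(\sum_i k_i+\sum_i x_i)}}\prod_{i=1}^s\frac{(k_i)_{(x_i)}}{x_i!}$. A point process $N$ on a complete separable metric space $\mathcal S$ is a generalized Waring process with parameters $a,\rho,k>0$ and parameter measure $\mu$ (a boundedly finite Borel measure) if for every finite family of pairwise disjoint bounded Borel sets $A_1,\dots,A_l$, $(N(A_1),\dots,N(A_l))$ has the $\mathrm{MGWD}(a;k\mu(A_1),\dots,k\mu(A_l);\rho)$ distribution. The negative binomial process with parameters $a,c>0$ (and parameter measure $\mu$) is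 the point process $N$ on $\mathcal S$ whose finite-dimensional distributions have probability generating functions $E\prod_{i=1}^n z_i^{N(A_i)}=\big(1+\tfrac1c\sum_{i=1}^n(1-z_i)\mu(A_i)\big)^{-a}$ for pairwise disjoint bounded Borel sets $A_1,\dots,A_n$ and $|z_i|\le1$ (the gamma-mixed Poisson process). *)

theory Defs
  imports "HOL-Probability.Probability"
begin

text \<open>Generalized rising factorial x_(beta) = Gamma(x+beta)/Gamma(x), with the
  conventions 0_(0) = 1 and 0_(beta) = 0 for beta > 0 (only integer beta occur there).\<close>
definition rising :: "real \<Rightarrow> real \<Rightarrow> real" where
  "rising x \<beta> = (if x = 0 then (if \<beta> = 0 then 1 else 0) else Gamma (x + \<beta>) / Gamma x)"

definition mgwd :: "real \<Rightarrow> nat \<Rightarrow> (nat \<Rightarrow> real) \<Rightarrow> real \<Rightarrow> (nat \<Rightarrow> nat) \<Rightarrow> real" where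
  "mgwd a l ks \<rho> xs =
     rising \<rho> (\<Sum>i<l. ks i) * rising a (\<Sum>i<l. real (xs i))
       / rising (\<rho> + a) ((\<Sum>i<l. ks i) + (\<Sum>i<l. real (xs i)))
     * (\<Prod>i<l. rising (ks i) (real (xs i)) / fact (xs i))"

definition bf_counting :: "'a::metric_space measure \<Rightarrow> bool" where
  "bf_counting \<xi> \<longleftrightarrow> sets \<xi> = sets borel \<and>
     (\<forall>A\<in>sets borel. bounded A \<longrightarrow> emeasure \<xi> A \<in> range of_nat)"

definition wsharp_conv :: "(nat \<Rightarrow> 'a::metric_space measure) \<Rightarrow> 'a measure \<Rightarrow> bool" where
  "wsharp_conv \<xi>s \<xi> \<longleftrightarrow>
     (\<forall>f :: 'a \<Rightarrow> real. continuous_on UNIV f \<and> bounded (range f) \<and> bounded {x. f x \<noteq> 0} \<longrightarrow>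
        (\<lambda>n. integral\<^sup>L (\<xi>s n) f) \<longlonglongrightarrow> integral\<^sup>L \<xi> f)"

text \<open>Continuity (= sequential continuity, the w# topology being metrizable) of a
  functional on the space of boundedly finite counting measures.\<close>
definition wsharp_continuous :: "('a::metric_space measure \<Rightarrow> real) \<Rightarrow> bool" where
  "wsharp_continuous F \<longleftrightarrow>
     (\<forall>\<xi>s \<xi>. (\<forall>n. bf_counting (\<xi>s n)) \<and> bf_counting \<xi> \<and> wsharp_conv \<xi>s \<xi> \<longrightarrow>
        (\<lambda>n. F (\<xi>s n)) \<longlonglongrightarrow> F \<xi>)"

definition point_process :: "'w measure \<Rightarrow> ('w \<Rightarrow> 'a::metric_space measure) \<Rightarrow> bool" where
  "point_process M N \<longleftrightarrow> prob_space M \<and> (\<forall>\<omega>\<in>space M. bf_counting (N \<omega>)) \<and>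
     (\<forall>A\<in>sets borel. bounded A \<longrightarrow> (\<lambda>\<omega>. emeasure (N \<omega>) A) \<in> borel_measurable M)"

definition cnt :: "'a measure \<Rightarrow> 'a set \<Rightarrow> nat" where
  "cnt \<xi> A = nat \<lfloor>enn2real (emeasure \<xi> A)\<rfloor>"

definition gen_waring :: "'w measure \<Rightarrow> ('w \<Rightarrow> 'a::metric_space measure) \<Rightarrow>
    real \<Rightarrow> real \<Rightarrow> real \<Rightarrow> 'a measure \<Rightarrow> bool" where
  "gen_waring M N a \<rho> k \<mu> \<longleftrightarrow> point_process M N \<and>
     (\<forall>l (A :: nat \<Rightarrow> 'a set) (xs :: nat \<Rightarrow> nat).
        (\<forall>i<l. A i \<in> sets borel \<and> bounded (A i)) \<and> disjoint_family_on A {..<l} \<longrightarrow>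
        measure M {\<omega>\<in>space M. \<forall>i<l. emeasure (N \<omega>) (A i) = of_nat (xs i)}
          = mgwd a l (\<lambda>i. k * measure \<mu> (A i)) \<rho> xs)"

definition neg_binomial_process :: "'w measure \<Rightarrow> ('w \<Rightarrow> 'a::metric_space measure) \<Rightarrow>
    real \<Rightarrow> real \<Rightarrow> 'a measure \<Rightarrow> bool" where
  "neg_binomial_process M N a c \<mu> \<longleftrightarrow> point_process M N \<and>
     (\<forall>l (A :: nat \<Rightarrow> 'a set) (z :: nat \<Rightarrow> complex).
        (\<forall>i<l. A i \<in> sets borel \<and> bounded (A i)) \<and> disjoint_family_on A {..<l} \<and>
        (\<forall>i<l. cmod (z i) \<le> 1) \<longrightarrow>
        (LINT \<omega>|M. (\<Prod>i<l. z i ^ cnt (N \<omega>) (A i)))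
          = (1 + (1 / complex_of_real c) * (\<Sum>i<l. (1 - z i) * complex_of_real (measure \<mu> (A i))))
              powr (- complex_of_real a))"

text \<open>Weak convergence (in distribution) of the point processes Ns k (on P k) to N (on Q):
  E F(Ns k) \<rightarrow> E F(N) for every bounded w#-continuous F.  (Measurability of F \<circ> N is
  automatic for point processes; it is listed only so that the expectations are meaningful.)\<close>
definition pp_weak_conv :: "(nat \<Rightarrow> 'w measure) \<Rightarrow> (nat \<Rightarrow> 'w \<Rightarrow> 'a::metric_space measure) \<Rightarrow>
    'v measure \<Rightarrow> ('v \<Rightarrow> 'a measure) \<Rightarrow> bool" where
  "pp_weak_conv P Ns Q N \<longleftrightarrow>
     (\<forall>F :: 'a measure \<Rightarrow> real. bounded (range F) \<and> wsharp_continuous F \<and>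
        (\<forall>k\<ge>1. (\<lambda>\<omega>. F (Ns k \<omega>)) \<in> borel_measurable (P k)) \<and> (\<lambda>\<omega>. F (N \<omega>)) \<in> borel_measurable Q \<longrightarrow>
        (\<lambda>k. \<integral>\<omega>. F (Ns k \<omega>) \<partial>P k) \<longlonglongrightarrow> (\<integral>\<omega>. F (N \<omega>) \<partial>Q))"

end

theory Submission
  imports Defs "HOL-Real_Asymp.Real_Asymp" "HOL-Library.Diagonal_Subsequence"
begin

text \<open>
  The ratio asymptotics of the Gamma function give the limit of the finite-dimensional
  probabilities of \<open>N\<^sub>k\<close>, and expanding the probability generating function of \<open>N\<close> one coordinate at
  a time identifies this limit with the finite-dimensional distribution of \<open>N\<close>.

  Convergence of the finite-dimensional distributions implies weak convergence. A boundedly finite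
  counting measure \<open>\<xi>\<close> is a locally finite sum of unit point masses; moving each of them to the
  nearest of the first \<open>m\<close> points of a dense sequence yields a discretization that depends on
  finitely many counts. For a \<open>w\<^sup>#\<close>-continuous \<open>F\<close> the value at the discretization approaches
  \<open>F \<xi>\<close> uniformly on compact sets, since any sequence in such a set has a subsequence along which
  all atoms converge. The counts in balls, and in balls with finitely many small balls removed, are
  tight uniformly in \<open>k\<close>, so \<open>N\<^sub>k\<close> lies in one compact set with probability close to 1.
\<close>

text \<open>Bounded closed sets of a general Polish space need not be compact, so bounds on the
  counts in balls do not confine a configuration to a compact set of measures. This is why a second
  family of counts is controlled: if it vanishes, the atoms in each ball lie in a totally bounded
  set. Continuity of \<open>F\<close> is given along sequences, so compactness enters as the
  extraction of subsequences. The discretization replaces laws on a space of measures by laws on a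
  countable set, where convergence of all point probabilities to those of a probability law already
  gives convergence of the expectations of every bounded function. Tightness is needed for every
  \<open>k \<ge> 1\<close> at once: convergence to the limit law handles all large \<open>k\<close>,
  continuity from above the finitely many others.\<close>

section \<open>Finite-dimensional distributions\<close>

text \<open>One half of Wendel's inequality, by log-convexity; applied at \<open>x\<close> and at \<open>x + s\<close> it pins down the ratio.\<close>

lemma Gamma_upper:
  fixes x s :: real assumes "x > 0" "0 \<le> s" "s \<le> 1"
  shows "Gamma (x + s) \<le> x powr s * Gamma x"
proof -
  have "(ln \<circ> Gamma) ((1 - s) *\<^sub>R x + s *\<^sub>R (x + 1)) \<le> (1 - s) * (ln \<circ> Gamma) x + s * (ln \<circ> Gamma) (x + 1)"
    by (rule convex_onD[OF log_convex_Gamma_real]) (use assms in auto)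
  moreover have "(1 - s) *\<^sub>R x + s *\<^sub>R (x + 1) = x + s" by (simp add: algebra_simps)
  moreover have "Gamma (x + 1) = x * Gamma x" using assms by (intro Gamma_plus1) (auto elim!: nonpos_Ints_cases')
  ultimately have "ln (Gamma (x + s)) \<le> (1 - s) * ln (Gamma x) + s * ln (x * Gamma x)" by simp
  also have "\<dots> = ln (x powr s * Gamma x)" using assms by (simp add: ln_mult ln_powr algebra_simps Gamma_real_pos less_imp_neq)
  finally show ?thesis using assms by (subst (asm) ln_le_cancel_iff) auto
qed

lemma Gamma_ratio_frac:
  fixes s :: real assumes "0 \<le> s" "s \<le> 1"
  shows "((\<lambda>x. Gamma (x + s) / (Gamma x * x powr s)) \<longlongrightarrow> 1) at_top"
proof (rule tendsto_sandwich)
  show "eventually (\<lambda>x. Gamma (x + s) / (Gamma x * x powr s) \<le> 1) at_top"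
    using eventually_gt_at_top[of 0]
  proof eventually_elim
    case (elim x) thus ?case using Gamma_upper[of x s] assms by (simp add: divide_le_eq mult.commute)
  qed
  show "eventually (\<lambda>x. x / (x + s) * ((x + s) / x) powr s \<le> Gamma (x + s) / (Gamma x * x powr s)) at_top"
    using eventually_gt_at_top[of 0]
  proof eventually_elim
    case (elim x)
    \<comment> \<open>The exponent \<open>1 - s\<close> moves the argument to \<open>x + 1\<close>,
      where the functional equation leads back to \<open>Gamma x\<close>; the upper bound thus turns
      into a lower bound for \<open>Gamma (x + s)\<close>.\<close>
    have "Gamma (x + s + (1 - s)) \<le> (x + s) powr (1 - s) * Gamma (x + s)" by (rule Gamma_upper) (use elim assms in auto)
    moreover have "Gamma (x + 1) = x * Gamma x" using elim by (intro Gamma_plus1) (auto elim!: nonpos_Ints_cases')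
    ultimately have "x * Gamma x \<le> (x + s) powr (1 - s) * Gamma (x + s)" by simp
    also have "(x + s) powr (1 - s) = (x + s) / (x + s) powr s" using elim assms by (simp add: powr_diff)
    finally have "x * Gamma x * (x + s) powr s \<le> (x + s) * Gamma (x + s)" using elim assms by (simp add: field_simps)
    hence "x * Gamma x * (x + s) powr s / ((x + s) * (Gamma x * x powr s)) \<le> (x + s) * Gamma (x + s) / ((x + s) * (Gamma x * x powr s))"
      using elim assms by (intro divide_right_mono) auto
    moreover have "Gamma x \<noteq> 0" using elim by (simp add: Gamma_real_pos less_imp_neq[symmetric])
    ultimately show ?case using elim assms by (simp add: powr_divide)
  qed
  show "((\<lambda>x. x / (x + s) * ((x + s) / x) powr s) \<longlongrightarrow> 1) at_top"
  proof -
    have "((\<lambda>x. x / (x + s)) \<longlongrightarrow> 1) at_top" "((\<lambda>x. (x + s) / x) \<longlongrightarrow> 1) at_top" by real_asymp+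
    from tendsto_mult[OF this(1) tendsto_powr[OF this(2) tendsto_const, of s]] show ?thesis by simp
  qed
qed simp

text \<open>The fractional part of \<open>b\<close> is the previous lemma. Raising the shift by 1
  multiplies the quotient by (x + shift) / x, which tends to 1, so the integer part follows by
  induction.\<close>

lemma Gamma_ratio:
  fixes b :: real assumes "0 \<le> b"
  shows "((\<lambda>x. Gamma (x + b) / (Gamma x * x powr b)) \<longlongrightarrow> 1) at_top"
proof -
  have "((\<lambda>x. Gamma (x + (s + real n)) / (Gamma x * x powr (s + real n))) \<longlongrightarrow> 1) at_top" if "0 \<le> s" "s \<le> 1" for s n
  proof (induction n)
    case 0 thus ?case using Gamma_ratio_frac[OF that] by simp
  next
    case (Suc n)
    have "((\<lambda>x. (x + (s + real n)) / x) \<longlongrightarrow> 1) at_top" by real_asymp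
    from tendsto_mult[OF Suc this]
    have *: "((\<lambda>x. Gamma (x + (s + real n)) / (Gamma x * x powr (s + real n)) * ((x + (s + real n)) / x)) \<longlongrightarrow> 1) at_top" by simp
    show ?case
    proof (rule Lim_transform_eventually[OF *])
      show "\<forall>\<^sub>F x in at_top. Gamma (x + (s + real n)) / (Gamma x * x powr (s + real n)) * ((x + (s + real n)) / x) =
        Gamma (x + (s + real (Suc n))) / (Gamma x * x powr (s + real (Suc n)))"
        using eventually_gt_at_top[of 0]
      proof eventually_elim
        case (elim x)
        have "Gamma (x + (s + real n) + 1) = (x + (s + real n)) * Gamma (x + (s + real n))"
          using elim that by (intro Gamma_plus1) (auto elim!: nonpos_Ints_cases')
        moreover have "x powr (s + real n + 1) = x powr (s + real n) * x" using elim by (simp add: powr_add)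
        ultimately show ?case by (simp add: algebra_simps)
      qed
    qed
  qed
  from this[of "frac b" "nat \<lfloor>b\<rfloor>"] have "((\<lambda>x. Gamma (x + (frac b + real (nat \<lfloor>b\<rfloor>))) / (Gamma x * x powr (frac b + real (nat \<lfloor>b\<rfloor>)))) \<longlongrightarrow> 1) at_top"
    by (simp add: frac_ge_0 less_imp_le[OF frac_lt_1])
  moreover have "frac b + real (nat \<lfloor>b\<rfloor>) = b" using assms by (simp add: frac_def)
  ultimately show ?thesis by simp
qed

text \<open>The case \<open>m = 0\<close> stands apart because \<open>k * m\<close> then does not
  tend to infinity; there the convention for \<open>rising 0\<close> agrees with
  \<open>0 ^ n\<close>, including \<open>0 ^ 0 = 1\<close>.\<close>

lemma rising_tendsto:
  fixes m :: real assumes "m \<ge> 0"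
  shows "(\<lambda>k. rising (real k * m) (real n) / real k ^ n) \<longlonglongrightarrow> m ^ n"
proof (cases "m = 0")
  case True
  hence "\<forall>\<^sub>F k in sequentially. m ^ n = rising (real k * m) (real n) / real k ^ n"
    by (intro always_eventually allI) (auto simp: rising_def)
  thus ?thesis by (rule Lim_transform_eventually[OF tendsto_const])
next
  case False
  with assms have m: "m > 0" by simp
  have "filterlim (\<lambda>k. real k * m) at_top sequentially" using m by real_asymp
  from filterlim_compose[OF Gamma_ratio this, of "real n"]
  have "(\<lambda>k. Gamma (real k * m + real n) / (Gamma (real k * m) * (real k * m) powr real n)) \<longlonglongrightarrow> 1" by simp
  from tendsto_mult[OF this tendsto_const[of "m ^ n"]]
  have *: "(\<lambda>k. Gamma (real k * m + real n) / (Gamma (real k * m) * (real k * m) powr real n) * m ^ n) \<longlonglongrightarrow> m ^ n" by simp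
  show ?thesis
  proof (rule Lim_transform_eventually[OF *])
    show "\<forall>\<^sub>F k in sequentially. Gamma (real k * m + real n) / (Gamma (real k * m) * (real k * m) powr real n) * m ^ n
       = rising (real k * m) (real n) / real k ^ n"
      using eventually_gt_at_top[of 0] by eventually_elim (use m in \<open>auto simp: rising_def powr_realpow field_simps\<close>)
  qed
qed

text \<open>The limit of the Waring probabilities, obtained from \<open>\<Gamma>(x + b) / \<Gamma>(x) \<sim> x powr b\<close>.\<close>

definition nb_prob :: "real \<Rightarrow> real \<Rightarrow> nat \<Rightarrow> (nat \<Rightarrow> real) \<Rightarrow> (nat \<Rightarrow> nat) \<Rightarrow> real" where
  "nb_prob a c l ms xs = pochhammer a (\<Sum>i<l. xs i) * c powr a
     * (c + (\<Sum>i<l. ms i)) powr (- a - real (\<Sum>i<l. xs i)) * (\<Prod>i<l. ms i ^ xs i / fact (xs i))"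

text \<open>The shifts in the two rising factorials based on \<open>c * k\<close> and
  \<open>c * k + a\<close> grow with \<open>k\<close>, whereas \<open>Gamma_ratio\<close> concerns a
  fixed shift. Pairing the four Gamma values differently, Gamma(ck + a) with Gamma(ck) and Gamma((c
  + s)k + a + X) with Gamma((c + s)k), leaves the fixed shifts a and a + X. The powers of k are then
  a in the numerator, a + X in the denominator and X from the product, and they cancel.\<close>

lemma mgwd_tendsto:
  assumes a: "a > 0" and c: "c > 0" and ms: "\<And>i. i < l \<Longrightarrow> ms i \<ge> 0"
  shows "(\<lambda>k. mgwd a l (\<lambda>i. real k * ms i) (c * real k) xs) \<longlonglongrightarrow> nb_prob a c l ms xs"
proof -
  define s X where "s = (\<Sum>i<l. ms i)" and "X = (\<Sum>i<l. xs i)"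
  have s: "s \<ge> 0" unfolding s_def by (intro sum_nonneg) (use ms in auto)
  define g1 where "g1 k = Gamma (c * real k + a) / (Gamma (c * real k) * (c * real k) powr a)" for k
  define g2 where "g2 k = Gamma ((c + s) * real k + (a + real X)) / (Gamma ((c + s) * real k) * ((c + s) * real k) powr (a + real X))" for k
  have "filterlim (\<lambda>k. c * real k) at_top sequentially" using c by real_asymp
  from filterlim_compose[OF Gamma_ratio this, of a] have g1: "g1 \<longlonglongrightarrow> 1" using a by (simp add: g1_def[abs_def])
  have "c + s > 0" using c s by simp
  hence "filterlim (\<lambda>k. (c + s) * real k) at_top sequentially" by real_asymp
  from filterlim_compose[OF Gamma_ratio this, of "a + real X"] have g2: "g2 \<longlonglongrightarrow> 1" using a by (simp add: g2_def[abs_def])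
  define p where "p k = (\<Prod>i<l. rising (real k * ms i) (real (xs i)) / real k ^ xs i / fact (xs i))" for k
  have p: "p \<longlonglongrightarrow> (\<Prod>i<l. ms i ^ xs i / fact (xs i))" unfolding p_def
    by (intro tendsto_prod tendsto_divide rising_tendsto tendsto_const) (use ms in auto)
  have lim: "(\<lambda>k. g1 k / g2 k * (c powr a * (c + s) powr (- a - real X) * pochhammer a X) * p k)
      \<longlonglongrightarrow> 1 / 1 * (c powr a * (c + s) powr (- a - real X) * pochhammer a X) * (\<Prod>i<l. ms i ^ xs i / fact (xs i))"
    by (intro tendsto_mult tendsto_divide g1 g2 p tendsto_const) simp
  have eq: "1 / 1 * (c powr a * (c + s) powr (- a - real X) * pochhammer a X) * (\<Prod>i<l. ms i ^ xs i / fact (xs i))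
    = nb_prob a c l ms xs" by (simp add: nb_prob_def s_def X_def)
  show ?thesis
  proof (rule Lim_transform_eventually[OF lim[unfolded eq]])
    show "\<forall>\<^sub>F k in sequentially. g1 k / g2 k * (c powr a * (c + s) powr (- a - real X) * pochhammer a X) * p k
      = mgwd a l (\<lambda>i. real k * ms i) (c * real k) xs"
      using eventually_gt_at_top[of 0]
    proof eventually_elim
      case (elim k)
      define r where "r = real k"
      have r: "r > 0" using elim by (simp add: r_def)
      have cs: "c + s > 0" using c s by simp
      have pr: "p k = (\<Prod>i<l. rising (r * ms i) (real (xs i)) / fact (xs i)) / r ^ X"
        by (simp add: p_def r_def X_def power_sum prod_dividef prod.distrib divide_divide_eq_left mult.commute)
      have po: "pochhammer a X = Gamma (a + real X) / Gamma a"
        using a by (intro pochhammer_Gamma) (auto elim!: nonpos_Ints_cases')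
      have nz: "Gamma (c * r) \<noteq> 0" "Gamma ((c + s) * r) \<noteq> 0" "Gamma (c * r + a) \<noteq> 0" "Gamma ((c + s) * r + (a + real X)) \<noteq> 0" "Gamma a \<noteq> 0"
        using a c r s cs by (auto intro!: less_imp_neq[symmetric] Gamma_real_pos add_pos_nonneg mult_pos_pos)
      have pw: "(c * r) powr a = c powr a * r powr a" "((c + s) * r) powr (a + real X) = (c + s) powr (a + real X) * r powr a * r ^ X"
        "(c + s) powr (- a - real X) = 1 / (c + s) powr (a + real X)"
        using c r cs powr_minus_divide[of "c + s" "a + real X"] by (simp_all add: powr_mult powr_add powr_realpow del: powr_minus_divide)
      have ks: "(\<Sum>i<l. r * ms i) = r * s" "(\<Sum>i<l. real (xs i)) = real X" by (auto simp: s_def X_def sum_distrib_left)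
      have "mgwd a l (\<lambda>i. r * ms i) (c * r) xs = Gamma ((c + s) * r) / Gamma (c * r) * pochhammer a X
          / (Gamma ((c + s) * r + (a + real X)) / Gamma (c * r + a)) * (\<Prod>i<l. rising (r * ms i) (real (xs i)) / fact (xs i))"
      proof -
        have e: "c * r + r * s = (c + s) * r" "c * r + a + (r * s + real X) = (c + s) * r + (a + real X)" by (auto simp: algebra_simps)
        show ?thesis unfolding mgwd_def ks rising_def[of "c * r"] rising_def[of a] rising_def[of "c * r + a"] e
          using a c r by (simp add: po add_pos_pos less_imp_neq[symmetric])
      qed
      also have "\<dots> = g1 k / g2 k * (c powr a * (c + s) powr (- a - real X) * pochhammer a X) * p k"
        using nz c r cs unfolding g1_def g2_def pr pw r_def[symmetric] by (simp add: field_simps)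
      finally show ?case by (simp add: r_def)
    qed
  qed
qed

section \<open>Power series and probability generating functions\<close>

text \<open>Once the coefficients below \<open>n\<close> vanish, the series can be divided by
  \<open>t ^ n\<close>, and letting t tend to 0 isolates \<open>d n\<close>.\<close>

lemma powser_zero_imp_coeff_zero:
  fixes d :: "nat \<Rightarrow> real"
  assumes "\<And>t. \<bar>t\<bar> < 1 \<Longrightarrow> (\<lambda>n. d n * t ^ n) sums 0"
  shows "d n = 0"
proof (induction n rule: less_induct)
  case (less n)
  have "((\<lambda>t. 0) \<longlongrightarrow> d (0 + n)) (at (0::real))"
  proof (rule powser_limit_0_strong[where s = 1])
    fix t :: real assume t: "t \<noteq> 0" "norm t < 1"
    have "(\<lambda>k. d (k + n) * t ^ (k + n)) sums (0 - (\<Sum>i<n. d i * t ^ i))"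
      using assms[of t] t by (intro sums_split_initial_segment) auto
    hence "(\<lambda>k. d (k + n) * t ^ (k + n) / t ^ n) sums (0 / t ^ n)"
      using less by (intro sums_divide) simp
    thus "(\<lambda>k. d (k + n) * t ^ k) sums 0" using t by (simp add: power_add)
  qed simp
  thus ?case by (simp add: tendsto_const_iff)
qed

text \<open>The binomial series for the exponent \<open>- b\<close>: the sign in the generalized
  binomial coefficient cancels against that of \<open>(- y) ^ n\<close> and leaves a Pochhammer
  symbol.\<close>

lemma gen_binomial_neg:
  fixes D b y :: real assumes "\<bar>y\<bar> < D"
  shows "(\<lambda>n. pochhammer b n / fact n * D powr (- b - real n) * y ^ n) sums (D - y) powr (- b)"
proof -
  have "(\<lambda>n. (- b gchoose n) * D powr (- b - real n) * (- y) ^ n) sums (D + - y) powr (- b)"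
    using assms by (intro gen_binomial_real'') auto
  moreover have "(- b gchoose n) * D powr (- b - real n) * (- y) ^ n
     = pochhammer b n / fact n * D powr (- b - real n) * y ^ n" for n
  proof -
    have "(- 1 :: real) ^ n * (- y) ^ n = y ^ n" by (subst power_mult_distrib[symmetric]) simp
    thus ?thesis by (simp add: gbinomial_pochhammer)
  qed
  ultimately show ?thesis by simp
qed

text \<open>Expands a generating function in one variable under a weight \<open>h\<close>, which
  will carry the event already fixed for earlier coordinates and the variables of later ones.
  Dominated convergence applies to the truncations to \<open>V \<omega> < k\<close>.\<close>

lemma sums_integral_power:
  fixes V :: "'v \<Rightarrow> nat" and h :: "'v \<Rightarrow> real"
  assumes "prob_space Q" and V[measurable]: "V \<in> measurable Q (count_space UNIV)"
    and h[measurable]: "h \<in> borel_measurable Q" and h1: "\<And>\<omega>. \<bar>h \<omega>\<bar> \<le> 1" and t: "\<bar>t\<bar> \<le> 1"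
  shows "(\<lambda>n. (\<integral>\<omega>. (if V \<omega> = n then h \<omega> else 0) \<partial>Q) * t ^ n) sums (\<integral>\<omega>. h \<omega> * t ^ V \<omega> \<partial>Q)"
proof -
  interpret prob_space Q by fact
  have int: "integrable Q (\<lambda>\<omega>. (if V \<omega> = n then h \<omega> else 0))" for n
    by (rule integrable_const_bound[of _ 1]) (use h1 in auto)
  have "(\<lambda>k. \<integral>\<omega>. (if V \<omega> < k then h \<omega> * t ^ V \<omega> else 0) \<partial>Q) \<longlonglongrightarrow> (\<integral>\<omega>. h \<omega> * t ^ V \<omega> \<partial>Q)"
  proof (rule integral_dominated_convergence[where w = "\<lambda>_. 1"])
    show "AE \<omega> in Q. (\<lambda>k. if V \<omega> < k then h \<omega> * t ^ V \<omega> else 0) \<longlonglongrightarrow> h \<omega> * t ^ V \<omega>"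
    proof (rule AE_I2)
      fix \<omega>
      show "(\<lambda>k. if V \<omega> < k then h \<omega> * t ^ V \<omega> else 0) \<longlonglongrightarrow> h \<omega> * t ^ V \<omega>"
        by (rule Lim_transform_eventually[OF tendsto_const])
           (use eventually_gt_at_top[of "V \<omega>"] in eventually_elim, simp)
    qed
    show "AE \<omega> in Q. norm (if V \<omega> < k then h \<omega> * t ^ V \<omega> else 0) \<le> 1" for k
      using h1 t by (intro AE_I2) (auto simp: abs_mult power_abs intro!: mult_le_one power_le_one)
  qed auto
  moreover have "(\<Sum>n<k. (\<integral>\<omega>. (if V \<omega> = n then h \<omega> else 0) \<partial>Q) * t ^ n)
      = (\<integral>\<omega>. (if V \<omega> < k then h \<omega> * t ^ V \<omega> else 0) \<partial>Q)" for k
  proof -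
    have "(\<Sum>n<k. (\<integral>\<omega>. (if V \<omega> = n then h \<omega> else 0) \<partial>Q) * t ^ n)
       = (\<integral>\<omega>. (\<Sum>n<k. (if V \<omega> = n then h \<omega> else 0) * t ^ n) \<partial>Q)"
      using int by (subst Bochner_Integration.integral_sum) auto
    also have "(\<lambda>\<omega>. (\<Sum>n<k. (if V \<omega> = n then h \<omega> else 0) * t ^ n)) = (\<lambda>\<omega>. (if V \<omega> < k then h \<omega> * t ^ V \<omega> else 0))"
      by (auto simp: if_distrib[of "\<lambda>x. x * _"] sum.delta cong: if_cong)
    finally show ?thesis .
  qed
  ultimately show ?thesis by (simp add: sums_def)
qed

text \<open>Only the generating function on a real cube is used. The coordinates are turned into point probabilities one at a time: after \<open>r\<close> steps the first \<open>r\<close> counts are prescribed and the remaining ones still carry a variable \<open>z i\<close>, and the next step compares coefficients of the power series in \<open>z r\<close>.\<close>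

lemma pgf_imp_nb_prob:
  fixes V :: "nat \<Rightarrow> 'v \<Rightarrow> nat"
  assumes ps: "prob_space Q" and V[measurable]: "\<And>i. i < l \<Longrightarrow> V i \<in> measurable Q (count_space UNIV)"
    and c: "c > 0" and ms: "\<And>i. i < l \<Longrightarrow> ms i \<ge> 0"
    and pgf: "\<And>z :: nat \<Rightarrow> real. (\<And>i. i < l \<Longrightarrow> \<bar>z i\<bar> \<le> 1) \<Longrightarrow>
      (\<integral>\<omega>. (\<Prod>i<l. z i ^ V i \<omega>) \<partial>Q) = (1 + 1 / c * (\<Sum>i<l. (1 - z i) * ms i)) powr (- a)"
  shows "measure Q {\<omega>\<in>space Q. \<forall>i<l. V i \<omega> = xs i} = nb_prob a c l ms xs"
proof -
  interpret prob_space Q by fact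
  define s where "s = (\<Sum>i<l. ms i)"
  define X where "X r = (\<Sum>i<r. xs i)" for r
  define H where "H r z \<omega> = (if \<forall>i<r. V i \<omega> = xs i then \<Prod>i\<in>{r..<l}. z i ^ V i \<omega> else 0)" for r and z :: "nat \<Rightarrow> real" and \<omega>
  \<comment> \<open>\<open>D r z\<close> is \<open>c\<close> times the base of the generating
    function with \<open>z i\<close> set to 0 for \<open>i < r\<close>. Taking the n-th coefficient
    in a variable lowers the exponent by n, whence the exponent \<open>- a - X r\<close> in
    \<open>main\<close>; \<open>A r\<close> gathers the constants produced on the way.\<close>
  define A where "A r = pochhammer a (X r) * c powr a * (\<Prod>i<r. ms i ^ xs i / fact (xs i))" for r
  define D where "D r z = c + s - (\<Sum>i\<in>{r..<l}. z i * ms i)" for r and z :: "nat \<Rightarrow> real"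
  have Hm: "H r z \<in> borel_measurable Q" if "r \<le> l" for r z
  proof -
    have [measurable]: "V i \<in> measurable Q (count_space UNIV)" if "i < r" for i using that \<open>r \<le> l\<close> by (intro V) auto
    have [measurable]: "V i \<in> measurable Q (count_space UNIV)" if "i \<in> {r..<l}" for i using that by (intro V) auto
    have "(\<lambda>\<omega>. if \<forall>i\<in>{..<r}. V i \<omega> = xs i then \<Prod>i\<in>{r..<l}. z i ^ V i \<omega> else 0) \<in> borel_measurable Q"
      by measurable
    thus ?thesis by (simp add: H_def[abs_def] Ball_def)
  qed
  have H1: "\<bar>H r z \<omega>\<bar> \<le> 1" if "\<And>i. i < l \<Longrightarrow> \<bar>z i\<bar> \<le> 1" for r z \<omega>
    using that by (auto simp: H_def abs_prod power_abs intro!: prod_le_1 power_le_one)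
  \<comment> \<open>The margin \<open>c\<close> keeps \<open>t * ms r\<close> strictly below the
    base \<open>D (Suc r) z\<close> for all \<open>\<bar>t\<bar> < 1\<close>, as the binomial series
    requires.\<close>
  have Dm: "D (Suc r) z \<ge> c + ms r" if "r < l" and z: "\<And>i. i < l \<Longrightarrow> \<bar>z i\<bar> \<le> 1" for r z
  proof -
    have "(\<Sum>i\<in>{Suc r..<l}. z i * ms i) \<le> (\<Sum>i\<in>{Suc r..<l}. ms i)"
    proof (rule sum_mono)
      fix i assume "i \<in> {Suc r..<l}"
      hence "z i \<le> 1" "ms i \<ge> 0" using z[of i] ms by auto
      thus "z i * ms i \<le> ms i" by (metis mult_left_le mult.commute)
    qed
    moreover have "ms r + (\<Sum>i\<in>{Suc r..<l}. ms i) = (\<Sum>i\<in>{r..<l}. ms i)" using \<open>r < l\<close> by (simp add: sum.atLeast_Suc_lessThan)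
    moreover have "(\<Sum>i\<in>{r..<l}. ms i) \<le> s" unfolding s_def using ms by (intro sum_mono2) auto
    ultimately show ?thesis by (simp add: D_def)
  qed
  have main: "(\<integral>\<omega>. H r z \<omega> \<partial>Q) = A r * D r z powr (- a - real (X r))"
    if "r \<le> l" "\<And>i. i < l \<Longrightarrow> \<bar>z i\<bar> \<le> 1" for r z
    using that
  proof (induction r arbitrary: z)
    case 0
    have "(\<Sum>i<l. z i * ms i) \<le> (\<Sum>i<l. ms i)"
    proof (rule sum_mono)
      fix i assume "i \<in> {..<l}"
      hence "z i \<le> 1" "ms i \<ge> 0" using 0(2)[of i] ms by auto
      thus "z i * ms i \<le> ms i" by (metis mult_left_le mult.commute)
    qed
    hence D0: "D 0 z > 0" using c by (simp add: D_def s_def lessThan_atLeast0)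
    have "(\<integral>\<omega>. H 0 z \<omega> \<partial>Q) = (1 + 1 / c * (\<Sum>i<l. (1 - z i) * ms i)) powr (- a)"
      using pgf[OF 0(2)] by (simp add: H_def lessThan_atLeast0)
    also have "1 + 1 / c * (\<Sum>i<l. (1 - z i) * ms i) = D 0 z / c"
      using c by (simp add: D_def s_def lessThan_atLeast0 left_diff_distrib sum_subtractf field_simps)
    also have "(D 0 z / c) powr (- a) = A 0 * D 0 z powr (- a - real (X 0))"
      using c D0 by (simp add: A_def X_def powr_divide powr_minus field_simps)
    finally show ?case .
  next
    case (Suc r)
    hence r: "r < l" by simp
    define d where "d n = (\<integral>\<omega>. (if V r \<omega> = n then (if \<forall>i<r. V i \<omega> = xs i then \<Prod>i\<in>{Suc r..<l}. z i ^ V i \<omega> else 0) else 0) \<partial>Q)" for n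
    \<comment> \<open>The value 1 deletes the factor of coordinate \<open>r\<close>, so
      \<open>h\<close> is the weight that multiplies \<open>t ^ V r \<omega>\<close>.\<close>
    define h where "h = H r (z(r := 1))"
    have h: "h \<omega> = (if \<forall>i<r. V i \<omega> = xs i then \<Prod>i\<in>{Suc r..<l}. z i ^ V i \<omega> else 0)" for \<omega>
      using r by (auto simp: h_def H_def prod.atLeast_Suc_lessThan)
    have d: "d n = (\<integral>\<omega>. (if V r \<omega> = n then h \<omega> else 0) \<partial>Q)" for n
      unfolding d_def h ..
    have hH: "h \<omega> * t ^ V r \<omega> = H r (z(r := t)) \<omega>" for t \<omega>
      using r by (auto simp: h H_def prod.atLeast_Suc_lessThan)
    define b where "b = a + real (X r)"
    \<comment> \<open>The coefficients of the closed form given by the induction hypothesis, whose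
      base as a function of the variable t at position \<open>r\<close> is
      \<open>D (Suc r) z - t * ms r\<close>.\<close>
    define e where "e n = A r * (pochhammer b n / fact n * D (Suc r) z powr (- b - real n) * ms r ^ n)" for n
    have "(\<lambda>n. (d n - e n) * t ^ n) sums 0" if t: "\<bar>t\<bar> < 1" for t
    proof -
      have zt: "\<bar>(z(r := t)) i\<bar> \<le> 1" if "i < l" for i using Suc.prems(2)[OF that] t by auto
      have "(\<lambda>n. d n * t ^ n) sums (\<integral>\<omega>. H r (z(r := t)) \<omega> \<partial>Q)"
        unfolding d hH[symmetric]
        by (rule sums_integral_power[OF ps V[OF r]])
           (use r t Suc.prems(2) in \<open>auto simp: h_def intro!: Hm H1\<close>)
      also have "(\<integral>\<omega>. H r (z(r := t)) \<omega> \<partial>Q) = A r * D r (z(r := t)) powr (- b)"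
        unfolding b_def minus_add_distrib diff_conv_add_uminus[symmetric] by (rule Suc.IH) (use r zt in \<open>auto simp del: fun_upd_apply\<close>)
      also have "D r (z(r := t)) = D (Suc r) z - t * ms r"
        using r by (simp add: D_def sum.atLeast_Suc_lessThan)
      finally have 1: "(\<lambda>n. d n * t ^ n) sums (A r * (D (Suc r) z - t * ms r) powr (- b))" .
      have "\<bar>t * ms r\<bar> \<le> ms r" using t ms[OF r] by (simp add: abs_mult mult_left_le_one_le)
      also have "ms r < D (Suc r) z" using Dm[OF r, of z] Suc.prems(2) c by simp
      finally have "(\<lambda>n. A r * (pochhammer b n / fact n * D (Suc r) z powr (- b - real n) * (t * ms r) ^ n)) sums (A r * (D (Suc r) z - t * ms r) powr (- b))"
        by (intro sums_mult gen_binomial_neg)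
      hence "(\<lambda>n. e n * t ^ n) sums (A r * (D (Suc r) z - t * ms r) powr (- b))"
        by (simp add: e_def power_mult_distrib mult_ac)
      from sums_diff[OF 1 this] show ?thesis by (simp add: left_diff_distrib)
    qed
    from powser_zero_imp_coeff_zero[of "\<lambda>n. d n - e n", OF this, of "xs r"] have de: "d (xs r) = e (xs r)" by simp
    have "H (Suc r) z \<omega> = (if V r \<omega> = xs r then h \<omega> else 0)" for \<omega>
      by (auto simp: H_def h less_Suc_eq)
    hence "(\<integral>\<omega>. H (Suc r) z \<omega> \<partial>Q) = d (xs r)" by (simp add: d)
    also have "\<dots> = A (Suc r) * D (Suc r) z powr (- a - real (X (Suc r)))"
    proof -
      have X: "X (Suc r) = X r + xs r" by (simp add: X_def)
      show ?thesis unfolding de e_def A_def b_def X pochhammer_product' by (simp add: algebra_simps)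
    qed
    finally show ?case .
  qed
  have "measure Q {\<omega>\<in>space Q. \<forall>i<l. V i \<omega> = xs i} = (\<integral>\<omega>. indicator {\<omega>\<in>space Q. \<forall>i<l. V i \<omega> = xs i} \<omega> \<partial>Q)"
    by simp
  also have "\<dots> = (\<integral>\<omega>. H l (\<lambda>_. 1) \<omega> \<partial>Q)"
    by (intro Bochner_Integration.integral_cong) (auto simp: H_def indicator_def)
  also have "\<dots> = nb_prob a c l ms xs"
    by (subst main) (auto simp: A_def D_def X_def s_def nb_prob_def)
  finally show ?thesis .
qed

section \<open>Counting measures as sums of point masses\<close>

text \<open>\<open>c n\<close> unit atoms \<open>x (n, i)\<close> in group \<open>n\<close>; the groups will be the shells of unit width around a base point.\<close>

definition atomic :: "(nat \<Rightarrow> nat) \<Rightarrow> (nat \<times> nat \<Rightarrow> 'a::topological_space) \<Rightarrow> 'a measure" where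
  "atomic c x = distr (count_space (SIGMA n:UNIV. {..<c n})) borel x"

lemma sets_atomic [simp, measurable_cong]: "sets (atomic c x) = sets borel"
  by (simp add: atomic_def)

lemma emeasure_atomic:
  assumes "A \<in> sets borel"
  shows "emeasure (atomic c x) A = emeasure (count_space UNIV) {p \<in> (SIGMA n:UNIV. {..<c n}). x p \<in> A}"
proof -
  have "emeasure (atomic c x) A = emeasure (count_space (SIGMA n:UNIV. {..<c n})) (x -` A \<inter> (SIGMA n:UNIV. {..<c n}))"
    using assms by (simp add: atomic_def emeasure_distr)
  also have "x -` A \<inter> (SIGMA n:UNIV. {..<c n}) = {p \<in> (SIGMA n:UNIV. {..<c n}). x p \<in> A}" by auto
  finally show ?thesis by (simp add: emeasure_count_space)
qed

lemma bf_counting_atomic: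
  fixes x :: "nat \<times> nat \<Rightarrow> 'a::metric_space"
  assumes "\<And>R. finite {p \<in> (SIGMA n:UNIV. {..<c n}). dist z (x p) \<le> R}"
  shows "bf_counting (atomic c x)"
  unfolding bf_counting_def
proof (intro conjI ballI impI)
  fix A :: "'a set" assume A: "A \<in> sets borel" "bounded A"
  then obtain R where "\<And>y. y \<in> A \<Longrightarrow> dist z y \<le> R" using bounded_any_center[of A z] by auto
  hence "finite {p \<in> (SIGMA n:UNIV. {..<c n}). x p \<in> A}"
    by (intro finite_subset[OF _ assms[of R]]) auto
  thus "emeasure (atomic c x) A \<in> range of_nat" using A by (simp add: emeasure_atomic)
qed simp

lemma integral_atomic:
  fixes f :: "'a::topological_space \<Rightarrow> real"
  assumes [measurable]: "f \<in> borel_measurable borel"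
    and z: "\<And>n i. i < c n \<Longrightarrow> R \<le> n \<Longrightarrow> f (x (n, i)) = 0"
  shows "integral\<^sup>L (atomic c x) f = (\<Sum>n<R. \<Sum>i<c n. f (x (n, i)))"
proof -
  let ?S = "SIGMA n:{..<R}. {..<c n}"
  have "integral\<^sup>L (atomic c x) f = (\<integral>p. f (x p) \<partial>count_space (SIGMA n:UNIV. {..<c n}))"
    unfolding atomic_def by (subst integral_distr) auto
  also have "\<dots> = (\<Sum>p | p \<in> (SIGMA n:UNIV. {..<c n}) \<and> f (x p) \<noteq> 0. f (x p))"
  proof (rule lebesgue_integral_count_space_finite_support)
    show "finite {p \<in> (SIGMA n:UNIV. {..<c n}). f (x p) \<noteq> 0}"
    proof (rule finite_subset)
      show "{p \<in> (SIGMA n:UNIV. {..<c n}). f (x p) \<noteq> 0} \<subseteq> ?S" using z not_le by auto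
    qed auto
  qed
  also have "\<dots> = (\<Sum>p\<in>?S. f (x p))"
    using z not_le by (intro sum.mono_neutral_left) auto
  also have "\<dots> = (\<Sum>n<R. \<Sum>i<c n. f (x (n, i)))"
    by (subst sum.Sigma) (auto simp: case_prod_unfold)
  finally show ?thesis .
qed

lemma bf_countingD:
  assumes "bf_counting \<xi>" "A \<in> sets borel" "bounded A"
  shows "emeasure \<xi> A = of_nat (cnt \<xi> A)" "sets \<xi> = sets borel"
proof -
  from assms obtain n where "emeasure \<xi> A = of_nat n" by (auto simp: bf_counting_def)
  thus "emeasure \<xi> A = of_nat (cnt \<xi> A)" by (simp add: cnt_def)
  show "sets \<xi> = sets borel" using assms by (simp add: bf_counting_def)
qed

section \<open>Atoms of boundedly finite counting measures\<close>

definition dense_seq :: "nat \<Rightarrow> 'a::polish_space" where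
  "dense_seq = (SOME d. \<forall>X. open X \<longrightarrow> X \<noteq> {} \<longrightarrow> (\<exists>n. d n \<in> X))"

lemma dense_seq_in: "open X \<Longrightarrow> X \<noteq> {} \<Longrightarrow> \<exists>n. dense_seq n \<in> X"
proof -
  obtain D :: "'a set" where D: "countable D" "\<And>X. open X \<Longrightarrow> X \<noteq> {} \<Longrightarrow> \<exists>d\<in>D. d \<in> X"
    using countable_dense_exists by auto
  hence ne: "D \<noteq> {}" by auto
  have "\<forall>X. open X \<longrightarrow> X \<noteq> {} \<longrightarrow> (\<exists>n. from_nat_into D n \<in> X)"
    using D ne by (metis from_nat_into_surj)
  hence "\<exists>d::nat \<Rightarrow> 'a. \<forall>X. open X \<longrightarrow> X \<noteq> {} \<longrightarrow> (\<exists>n. d n \<in> X)" by blast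
  from someI_ex[OF this] show "open X \<Longrightarrow> X \<noteq> {} \<Longrightarrow> \<exists>n. dense_seq n \<in> X" unfolding dense_seq_def by blast
qed

lemma dense_seq_near: "e > 0 \<Longrightarrow> \<exists>n. dist (dense_seq n) y < e"
  using dense_seq_in[of "ball y e"] by (auto simp: dist_commute)

text \<open>A set of nonzero mass is covered by countably many small balls, one of which meets it in
  nonzero mass. Iterating with radii tending to 0 gives a decreasing sequence of sets. Masses are
  integers, so they stay at least 1, and continuity from above leaves mass at least 1 on the
  intersection, which is then a single point.\<close>

lemma bf_counting_atom:
  fixes \<xi> :: "'a::polish_space measure"
  assumes bf: "bf_counting \<xi>" and B: "B \<in> sets borel" "bounded B" "emeasure \<xi> B \<noteq> 0"
  shows "\<exists>x\<in>B. emeasure \<xi> {x} \<noteq> 0"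
proof -
  have sets [simp]: "sets \<xi> = sets borel" using bf by (simp add: bf_counting_def)
  have "\<exists>C. \<forall>n. (C n \<in> sets borel \<and> C n \<subseteq> B \<and> emeasure \<xi> (C n) \<noteq> 0) \<and>
      (C (Suc n) \<subseteq> C n \<and> (\<exists>j. C (Suc n) \<subseteq> ball (dense_seq j) (1 / real (Suc n))))"
  proof (rule dependent_nat_choice, goal_cases)
    case 1 thus ?case using B by auto
  next
    case (2 C n)
    have "\<exists>j. emeasure \<xi> (C \<inter> ball (dense_seq j) (1 / real (Suc n))) \<noteq> 0"
    proof (rule ccontr)
      assume "\<nexists>j. emeasure \<xi> (C \<inter> ball (dense_seq j) (1 / real (Suc n))) \<noteq> 0"
      hence "emeasure \<xi> (\<Union>j. C \<inter> ball (dense_seq j) (1 / real (Suc n))) = 0"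
        using 2 by (intro emeasure_UN_eq_0) auto
      moreover have "(\<Union>j. C \<inter> ball (dense_seq j) (1 / real (Suc n))) = C"
        using dense_seq_near[of "1 / real (Suc n)"] by (auto simp del: of_nat_Suc)
      ultimately show False using 2 by simp
    qed
    then obtain j where "emeasure \<xi> (C \<inter> ball (dense_seq j) (1 / real (Suc n))) \<noteq> 0" by auto
    thus ?case using 2 by (intro exI[of _ "C \<inter> ball (dense_seq j) (1 / real (Suc n))"]) auto
  qed
  then obtain C where C: "\<And>n. C n \<in> sets borel" "\<And>n. C n \<subseteq> B" "\<And>n. emeasure \<xi> (C n) \<noteq> 0"
    "\<And>n. C (Suc n) \<subseteq> C n" "\<And>n. \<exists>j. C (Suc n) \<subseteq> ball (dense_seq j) (1 / real (Suc n))" by metis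
  have bC: "bounded (C n)" for n using C(2) B(2) by (rule bounded_subset[rotated])
  have "(\<lambda>n. emeasure \<xi> (C n)) \<longlonglongrightarrow> emeasure \<xi> (\<Inter>n. C n)"
  proof (rule Lim_emeasure_decseq)
    show "emeasure \<xi> (C n) \<noteq> \<infinity>" for n using bf_countingD(1)[OF bf C(1)[of n] bC[of n]] by simp
    show "decseq C" using C(4) by (rule decseq_SucI)
    show "range C \<subseteq> sets \<xi>" using C(1) by auto
  qed
  moreover have "1 \<le> emeasure \<xi> (C n)" for n
    using bf_countingD(1)[OF bf C(1)[of n] bC[of n]] C(3)[of n] by (cases "cnt \<xi> (C n)") auto
  ultimately have ge: "1 \<le> emeasure \<xi> (\<Inter>n. C n)" by (intro tendsto_lowerbound) auto
  then obtain x where x: "x \<in> (\<Inter>n. C n)" by (cases "(\<Inter>n. C n) = {}") auto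
  have "y = x" if y: "y \<in> (\<Inter>n. C n)" for y
  proof (rule ccontr)
    assume "y \<noteq> x"
    hence "dist y x / 2 > 0" by simp
    then obtain n where n: "1 / real (Suc n) < dist y x / 2" using nat_approx_posE by blast
    obtain j where "C (Suc n) \<subseteq> ball (dense_seq j) (1 / real (Suc n))" using C(5) by blast
    hence "dist (dense_seq j) y < 1 / real (Suc n)" "dist (dense_seq j) x < 1 / real (Suc n)" using x y by (auto simp del: of_nat_Suc)
    with n dist_triangle[of y x "dense_seq j"] show False by (simp add: dist_commute del: of_nat_Suc)
  qed
  with x have "(\<Inter>n. C n) = {x}" by blast
  moreover have "x \<in> B" using C(2) x by blast
  ultimately show ?thesis using ge by (intro bexI[of _ x]) auto
qed

text \<open>Induction on the count of \<open>B\<close>: removing an atom with its whole multiplicity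
  lowers the count. A list, unlike a set, records multiplicities.\<close>

lemma bf_counting_list:
  fixes \<xi> :: "'a::polish_space measure"
  assumes bf: "bf_counting \<xi>" and "B \<in> sets borel" "bounded B"
  shows "\<exists>xs. set xs \<subseteq> B \<and> (\<forall>A\<in>sets borel. emeasure \<xi> (A \<inter> B) = of_nat (length (filter (\<lambda>y. y \<in> A) xs)))"
  using assms(2,3)
proof (induction "cnt \<xi> B" arbitrary: B rule: less_induct)
  case less
  have sets [simp]: "sets \<xi> = sets borel" using bf by (simp add: bf_counting_def)
  show ?case
  proof (cases "emeasure \<xi> B = 0")
    case True
    have "emeasure \<xi> (A \<inter> B) = 0" if "A \<in> sets borel" for A
    proof -
      have "emeasure \<xi> (A \<inter> B) \<le> emeasure \<xi> B" using less.prems by (intro emeasure_mono) auto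
      thus ?thesis using True by simp
    qed
    thus ?thesis by (intro exI[of _ "[]"]) auto
  next
    case False
    obtain x where x: "x \<in> B" "emeasure \<xi> {x} \<noteq> 0" using bf_counting_atom[OF bf less.prems False] by auto
    let ?C = "B - {x}"
    define m where "m = cnt \<xi> {x}"
    have ex: "emeasure \<xi> {x} = of_nat m" unfolding m_def using bf by (intro bf_countingD) auto
    hence m: "m > 0" using x by (cases m) auto
    have Cs: "?C \<in> sets borel" "bounded ?C" using less.prems by (auto intro: bounded_subset)
    have "emeasure \<xi> B = emeasure \<xi> (?C \<union> {x})" using x by (simp add: insert_absorb)
    also have "\<dots> = emeasure \<xi> ?C + emeasure \<xi> {x}" using Cs by (subst plus_emeasure) auto
    finally have "of_nat (cnt \<xi> B) = (of_nat (cnt \<xi> ?C) + of_nat m :: ennreal)"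
      using bf_countingD(1)[OF bf] less.prems Cs ex by simp
    hence "of_nat (cnt \<xi> B) = (of_nat (cnt \<xi> ?C + m) :: ennreal)" by simp
    hence "cnt \<xi> B = cnt \<xi> ?C + m" by (simp only: of_nat_eq_iff)
    from less.hyps[OF _ Cs] this m obtain xs where xs: "set xs \<subseteq> ?C"
      "\<And>A. A\<in>sets borel \<Longrightarrow> emeasure \<xi> (A \<inter> ?C) = of_nat (length (filter (\<lambda>y. y \<in> A) xs))" by auto
    have "emeasure \<xi> (A \<inter> B) = of_nat (length (filter (\<lambda>y. y \<in> A) (replicate m x @ xs)))" if A: "A \<in> sets borel" for A
    proof (cases "x \<in> A")
      case True
      hence "emeasure \<xi> (A \<inter> B) = emeasure \<xi> ((A \<inter> ?C) \<union> {x})" using x by (intro arg_cong[of _ _ "emeasure \<xi>"]) auto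
      also have "\<dots> = emeasure \<xi> (A \<inter> ?C) + emeasure \<xi> {x}" using Cs A by (subst plus_emeasure) auto
      finally show ?thesis using True xs(2)[OF A] ex by (simp add: add.commute)
    next
      case False
      hence "A \<inter> B = A \<inter> ?C" by auto
      thus ?thesis using False xs(2)[OF A] by simp
    qed
    thus ?thesis using x xs(1) by (intro exI[of _ "replicate m x @ xs"]) (auto simp: set_replicate_conv_if)
  qed
qed

text \<open>Each of the disjoint shells \<open>S n\<close> is bounded, so
  \<open>bf_counting_list\<close> enumerates its atoms; both measures then agree on the part of any
  Borel set in each shell, and countable additivity gives equality.\<close>

lemma bf_counting_imp_atomic:
  fixes \<xi> :: "'a::polish_space measure" and z :: 'a
  assumes bf: "bf_counting \<xi>"
  shows "\<exists>c x. \<xi> = atomic c x \<and> (\<forall>n i. i < c n \<longrightarrow> real n \<le> dist z (x (n, i)) \<and> dist z (x (n, i)) < real n + 1)"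
proof -
  define S where "S n = {y. real n \<le> dist z y \<and> dist z y < real n + 1}" for n :: nat
  have S_eq: "S n = ball z (real n + 1) - ball z (real n)" for n by (auto simp: S_def)
  have Sb: "S n \<in> sets borel" "bounded (S n)" for n
    by (auto simp: S_eq intro: bounded_subset[OF bounded_ball])
  have disj: "disjoint_family S"
  proof (unfold disjoint_family_on_def, intro ballI impI)
    fix m n :: nat assume "m \<noteq> n"
    thus "S m \<inter> S n = {}" by (cases "m < n") (auto simp: S_def)
  qed
  have US: "(\<Union>n. S n) = UNIV"
  proof (intro equalityI subsetI UNIV_I)
    fix y
    have "y \<in> S (nat \<lfloor>dist z y\<rfloor>)" unfolding S_def by (auto simp: of_nat_nat)
    thus "y \<in> (\<Union>n. S n)" by blast
  qed
  have sets [simp]: "sets \<xi> = sets borel" using bf by (simp add: bf_counting_def)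
  from bf_counting_list[OF bf Sb] obtain L where L: "\<And>n. set (L n) \<subseteq> S n"
    "\<And>n A. A \<in> sets borel \<Longrightarrow> emeasure \<xi> (A \<inter> S n) = of_nat (length (filter (\<lambda>y. y \<in> A) (L n)))" by metis
  define c where "c n = length (L n)" for n
  define x where "x p = L (fst p) ! snd p" for p
  have xS: "x (n, i) \<in> S n" if "i < c n" for n i using that L(1)[of n] by (auto simp: c_def x_def)
  have "\<xi> = atomic c x"
  proof (rule measure_eqI)
    fix A assume "A \<in> sets \<xi>"
    hence A: "A \<in> sets borel" by simp
    have split: "emeasure \<eta> A = (\<Sum>n. emeasure \<eta> (A \<inter> S n))" if "sets \<eta> = sets borel" for \<eta> :: "'a measure"
    proof -
      have "(\<Sum>n. emeasure \<eta> (A \<inter> S n)) = emeasure \<eta> (\<Union>n. A \<inter> S n)"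
        
      proof (rule suminf_emeasure)
        show "disjoint_family (\<lambda>n. A \<inter> S n)" using disj unfolding disjoint_family_on_def by blast
      qed (use A Sb that in auto)
      also have "(\<Union>n. A \<inter> S n) = A" using US by auto
      finally show ?thesis ..
    qed
    have "emeasure (atomic c x) (A \<inter> S n) = emeasure \<xi> (A \<inter> S n)" for n
    proof -
      have "{p \<in> (SIGMA n:UNIV. {..<c n}). x p \<in> A \<inter> S n} = Pair n ` {i. i < length (L n) \<and> L n ! i \<in> A}"
      proof (intro equalityI subsetI)
        fix p assume p: "p \<in> {p \<in> (SIGMA n:UNIV. {..<c n}). x p \<in> A \<inter> S n}"
        obtain m i where mi: "p = (m, i)" by force
        have "x p \<in> S m" using xS p mi by auto
        hence "m = n" using p disj by (auto simp: disjoint_family_on_def)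
        thus "p \<in> Pair n ` {i. i < length (L n) \<and> L n ! i \<in> A}" using p mi by (auto simp: c_def x_def)
      qed (use L(1)[of n] in \<open>auto simp: c_def x_def\<close>)
      moreover have "card (Pair n ` {i. i < length (L n) \<and> L n ! i \<in> A}) = length (filter (\<lambda>y. y \<in> A) (L n))"
        by (subst card_image) (auto simp: inj_on_def length_filter_conv_card)
      moreover have "A \<inter> S n \<in> sets borel" using A Sb by auto
      ultimately show ?thesis using L(2)[OF A] by (simp add: emeasure_atomic emeasure_count_space)
    qed
    thus "emeasure \<xi> A = emeasure (atomic c x) A" by (simp add: split)
  qed simp
  thus ?thesis using xS by (intro exI[of _ c] exI[of _ x]) (auto simp: S_def)
qed

section \<open>Discretization\<close>

text \<open>The points whose first nearest neighbour among \<open>dense_seq 0, \<dots>, dense_seq m\<close> is \<open>dense_seq i\<close>, provided it is closer than 1. For \<open>i \<le> m\<close> these bounded sets are disjoint.\<close>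

definition cell :: "nat \<Rightarrow> nat \<Rightarrow> 'a::polish_space set" where
  "cell m i = {y. dist (dense_seq i) y < 1 \<and> (\<forall>j\<in>{..m}. dist (dense_seq i) y \<le> dist (dense_seq j) y) \<and>
                  (\<forall>j\<in>{..<i}. dist (dense_seq i) y < dist (dense_seq j) y)}"

lemma cell_borel [measurable]: "cell m i \<in> sets borel"
  unfolding cell_def by measurable

lemma bounded_cell: "bounded (cell m i)"
  by (rule bounded_subset[OF bounded_ball[of "dense_seq i" 1]]) (auto simp: cell_def)

lemma cell_unique: "y \<in> cell m i \<Longrightarrow> y \<in> cell m j \<Longrightarrow> i \<le> m \<Longrightarrow> j \<le> m \<Longrightarrow> i = j"
proof -
  have "\<not> i < j" if "y \<in> cell m i" "y \<in> cell m j" "j \<le> m" for i j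
  proof
    assume "i < j"
    hence "dist (dense_seq j) y < dist (dense_seq i) y" using that by (simp add: cell_def)
    moreover have "dist (dense_seq i) y \<le> dist (dense_seq j) y" using that by (simp add: cell_def)
    ultimately show False by simp
  qed
  thus "y \<in> cell m i \<Longrightarrow> y \<in> cell m j \<Longrightarrow> i \<le> m \<Longrightarrow> j \<le> m \<Longrightarrow> i = j" by (meson linorder_cases)
qed

lemma cell_exists:
  assumes "j \<le> m" "dist (dense_seq j) y < 1"
  shows "\<exists>i\<le>m. y \<in> cell m i \<and> dist (dense_seq i) y \<le> dist (dense_seq j) y"
proof -
  define D where "D = (\<lambda>i. dist (dense_seq i) y) ` {..m}"
  have "Min D \<in> D" unfolding D_def by (intro Min_in) auto
  then obtain k where "Min D = dist (dense_seq k) y" "k \<in> {..m}" unfolding D_def by (rule imageE)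
  hence ex: "\<exists>i. i \<le> m \<and> dist (dense_seq i) y = Min D" by auto
  \<comment> \<open>The least index among the minimizers matches the strict inequality against
    earlier points in \<open>cell\<close>.\<close>
  define i where "i = (LEAST i. i \<le> m \<and> dist (dense_seq i) y = Min D)"
  have i: "i \<le> m" "dist (dense_seq i) y = Min D" using LeastI_ex[OF ex] by (auto simp: i_def)
  have le: "Min D \<le> dist (dense_seq k) y" if "k \<le> m" for k unfolding D_def using that by (intro Min_le) auto
  have "Min D < dist (dense_seq k) y" if "k < i" for k
  proof -
    have "dist (dense_seq k) y \<noteq> Min D" using not_less_Least[of k "\<lambda>i. i \<le> m \<and> dist (dense_seq i) y = Min D"] that i by (auto simp: i_def)
    thus ?thesis using le[of k] that i by simp
  qed
  thus ?thesis using i le le[OF assms(1)] assms(2) by (intro exI[of _ i]) (auto simp: cell_def)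
qed

text \<open>\<open>disc m \<xi>\<close> moves every atom of \<open>\<xi>\<close> to the nearest of the first \<open>m + 1\<close> points of the dense sequence and drops the atoms lying in no cell, so it depends on finitely many counts only.\<close>

definition disc_of :: "nat \<Rightarrow> (nat \<Rightarrow> nat) \<Rightarrow> 'a::polish_space measure" where
  "disc_of m v = atomic (\<lambda>i. if i \<le> m then v i else 0) (\<lambda>p. dense_seq (fst p))"

definition disc :: "nat \<Rightarrow> 'a::polish_space measure \<Rightarrow> 'a measure" where
  "disc m \<xi> = disc_of m (\<lambda>i. cnt \<xi> (cell m i))"

lemma bf_counting_disc: "bf_counting (disc m \<xi>)"
  unfolding disc_def disc_of_def
proof (rule bf_counting_atomic)
  fix R
  show "finite {p \<in> (SIGMA n:UNIV. {..<if n \<le> m then cnt \<xi> (cell m n) else 0}). dist undefined (dense_seq (fst p) :: 'a) \<le> R}"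
    by (rule finite_subset[of _ "SIGMA n:{..m}. {..<cnt \<xi> (cell m n)}"]) (auto split: if_splits)
qed

text \<open>The test function composed with the map that moves a point to the centre of its cell,
  and 0 outside the cells: the dual, on functions, of \<open>disc m\<close> on measures.\<close>

definition snap :: "nat \<Rightarrow> ('a::polish_space \<Rightarrow> real) \<Rightarrow> 'a \<Rightarrow> real" where
  "snap m f y = (\<Sum>i\<le>m. indicator (cell m i) y * f (dense_seq i))"

lemma borel_measurable_snap [measurable]: "snap m f \<in> borel_measurable borel"
  unfolding snap_def[abs_def] by measurable

lemma snap_eq:
  assumes "i \<le> m" "y \<in> cell m i"
  shows "snap m f y = f (dense_seq i)"
proof -
  have "snap m f y = (\<Sum>k\<in>{i}. indicator (cell m k) y * f (dense_seq k))"
    unfolding snap_def using assms by (intro sum.mono_neutral_right) (auto simp: indicator_def dest: cell_unique)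
  thus ?thesis using assms by simp
qed

text \<open>The level \<open>m j\<close> and the point \<open>y j\<close> vary together. As soon as
  the level includes one dense point near \<open>y0\<close>, the centre chosen for
  \<open>y j\<close> is at least as close to \<open>y j\<close>, hence also near
  \<open>y0\<close>.\<close>

lemma snap_tendsto:
  fixes f :: "'a::polish_space \<Rightarrow> real"
  assumes f: "continuous_on UNIV f" and y: "y \<longlonglongrightarrow> y0" and m: "filterlim m at_top sequentially"
  shows "(\<lambda>j. snap (m j) f (y j)) \<longlonglongrightarrow> f y0"
proof (rule tendstoI)
  fix e :: real assume e: "e > 0"
  have "isCont f y0" using f by (simp add: continuous_on_eq_continuous_at)
  then obtain d where d: "d > 0" "\<And>w. dist w y0 < d \<Longrightarrow> dist (f w) (f y0) < e"
    using e unfolding continuous_at_eps_delta by auto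
  \<comment> \<open>The distance from \<open>dense_seq k\<close> to \<open>y j\<close> is below
    \<open>2 * h\<close>, which must be at most 1 for a cell to exist; the chosen centre is then
    within \<open>3 * h \<le> d\<close> of \<open>y0\<close>.\<close>
  define h where "h = min 1 d / 3"
  have h: "h > 0" "3 * h \<le> d" "2 * h < 1" using d by (auto simp: h_def)
  obtain k where k: "dist (dense_seq k) y0 < h" using dense_seq_near[OF h(1)] by blast
  have "\<forall>\<^sub>F j in sequentially. k \<le> m j" using m by (simp add: filterlim_at_top)
  moreover have "\<forall>\<^sub>F j in sequentially. dist (y j) y0 < h" using y h by (simp add: tendstoD)
  ultimately show "\<forall>\<^sub>F j in sequentially. dist (snap (m j) f (y j)) (f y0) < e"
  proof eventually_elim
    case (elim j)
    have dk: "dist (dense_seq k) (y j) < 2 * h" using elim k dist_triangle[of "dense_seq k" "y j" y0] by (simp add: dist_commute)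
    then obtain i where i: "i \<le> m j" "y j \<in> cell (m j) i" "dist (dense_seq i) (y j) \<le> dist (dense_seq k) (y j)"
      using cell_exists[of k "m j" "y j"] elim h by auto
    have "dist (dense_seq i) y0 < d" using dist_triangle[of "dense_seq i" y0 "y j"] i dk elim h by simp
    thus ?case using d snap_eq[OF i(1,2)] by simp
  qed
qed

text \<open>A point of a cell is at distance less than 1 from its centre, so snapping widens a
  support by at most 1.\<close>

lemma snap_eq_0:
  assumes "\<And>w. f w \<noteq> 0 \<Longrightarrow> dist z w < R" "R + 1 \<le> dist z y"
  shows "snap m f y = 0"
proof -
  have "indicator (cell m i) y * f (dense_seq i) = 0" for i
  proof (cases "y \<in> cell m i \<and> f (dense_seq i) \<noteq> 0")
    case True
    hence "dist z (dense_seq i) < R" "dist (dense_seq i) y < 1" using assms(1) by (auto simp: cell_def)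
    with assms(2) dist_triangle[of z y "dense_seq i"] show ?thesis by simp
  qed auto
  thus ?thesis unfolding snap_def by (intro sum.neutral ballI)
qed

lemma integral_disc:
  assumes bf: "bf_counting \<xi>" and [measurable]: "f \<in> borel_measurable borel"
  shows "integral\<^sup>L (disc m \<xi>) f = integral\<^sup>L \<xi> (snap m f)"
proof -
  have sets [simp, measurable_cong]: "sets \<xi> = sets borel" using bf by (simp add: bf_counting_def)
  have cc: "emeasure \<xi> (cell m i) = of_nat (cnt \<xi> (cell m i))" for i
    by (intro bf_countingD bf cell_borel bounded_cell)
  have int: "integrable \<xi> (\<lambda>y. indicator (cell m i) y * f (dense_seq i))" for i
    by (intro integrable_mult_left integrable_real_indicator) (auto simp: cc of_nat_less_top)
  have "integral\<^sup>L (disc m \<xi>) f = (\<Sum>n<Suc m. \<Sum>i<(if n \<le> m then cnt \<xi> (cell m n) else 0). f (dense_seq (fst (n, i))))"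
    unfolding disc_def disc_of_def by (rule integral_atomic) auto
  also have "\<dots> = (\<Sum>n\<le>m. real (cnt \<xi> (cell m n)) * f (dense_seq n))"
    by (intro sum.cong) auto
  also have "\<dots> = integral\<^sup>L \<xi> (snap m f)"
    unfolding snap_def[abs_def] using int by (subst Bochner_Integration.integral_sum) (auto simp: measure_def cc)
  finally show ?thesis .
qed

section \<open>Sequential compactness of the tight sets\<close>

text \<open>Sequential compactness of a countable product of compact metric spaces, by Cantor's
  diagonal argument.\<close>

lemma diagonal_convergent:
  fixes y :: "nat \<Rightarrow> 'i::countable \<Rightarrow> 'b::metric_space"
  assumes K: "\<And>i. compact (K i)" and y: "\<And>j i. y j i \<in> K i"
  shows "\<exists>r. strict_mono (r :: nat \<Rightarrow> nat) \<and> (\<forall>i. convergent (\<lambda>j. y (r j) i))"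
proof -
  let ?P = "\<lambda>n s. convergent (\<lambda>j. y (s j) (from_nat n))"
  interpret subseqs ?P
  proof
    fix n and s :: "nat \<Rightarrow> nat"
    have "seq_compact (K (from_nat n))" using K by (simp add: compact_imp_seq_compact)
    from seq_compactE[OF this, of "\<lambda>j. y (s j) (from_nat n)"] y
    obtain l r where "strict_mono r" "((\<lambda>j. y (s j) (from_nat n)) \<circ> r) \<longlonglongrightarrow> l" by metis
    thus "\<exists>r'. strict_mono r' \<and> ?P n (s \<circ> r')" by (auto simp: convergent_def o_def)
  qed
  have P: "?P n diagseq" for n
  proof -
    \<comment> \<open>Only the tail of the diagonal sequence from \<open>Suc n\<close> on is a
      subsequence of the one selected for coordinate \<open>n\<close>; the offset is removed
      afterwards.\<close>
    have "?P n (diagseq \<circ> (+) (Suc n))"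
    proof (rule diagseq_holds)
      fix r s :: "nat \<Rightarrow> nat" and k assume "strict_mono r" "?P k s"
      thus "?P k (s \<circ> r)" using convergent_subseq_convergent[of "\<lambda>j. y (s j) (from_nat k)" r] by (simp add: o_def)
    qed
    then obtain l where "(\<lambda>j. y (diagseq (j + Suc n)) (from_nat n)) \<longlonglongrightarrow> l" by (auto simp: convergent_def o_def add.commute)
    hence "(\<lambda>j. y (diagseq j) (from_nat n)) \<longlonglongrightarrow> l" by (rule LIMSEQ_offset)
    thus ?thesis by (auto simp: convergent_def)
  qed
  have "convergent (\<lambda>j. y (diagseq j) i)" for i using P[of "to_nat i"] by simp
  with subseq_diagseq show ?thesis by blast
qed

text \<open>For fixed \<open>n\<close> these sets decrease to the empty set as \<open>J \<rightarrow> \<infinity>\<close>.\<close>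

definition outer :: "'a::polish_space \<Rightarrow> nat \<Rightarrow> nat \<Rightarrow> 'a set" where
  "outer z J n = ball z (real n) - (\<Union>j\<in>{..J}. ball (dense_seq j) (1 / (real n + 1)))"

lemma outer_borel [measurable]: "outer z J n \<in> sets borel" by (simp add: outer_def)

lemma bounded_outer: "bounded (outer z J n)"
  by (rule bounded_subset[OF bounded_ball]) (auto simp: outer_def)

text \<open>Relatively compact: the atoms in a given ball are bounded in number and lie in a totally bounded set.\<close>

definition tight_set :: "'a::polish_space \<Rightarrow> (nat \<Rightarrow> nat) \<Rightarrow> (nat \<Rightarrow> nat) \<Rightarrow> 'a measure set" where
  "tight_set z M J = {\<xi>. bf_counting \<xi> \<and> (\<forall>n. cnt \<xi> (ball z (real n)) \<le> M n \<and> cnt \<xi> (outer z (J n) n) = 0)}"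

text \<open>Closed in a complete space, and totally bounded because a large \<open>n'\<close> gives
  a cover by finitely many balls of small radius. The indices \<open>n' > n\<close> are those for
  which the shell between radii \<open>n\<close> and \<open>n + 1\<close> lies in the ball of radius
  \<open>n'\<close>, so that an empty \<open>outer z (J n') n'\<close> constrains its atoms.\<close>

lemma compact_inner:
  fixes z :: "'a::polish_space"
  shows "compact (\<Inter>n'\<in>{n<..}. \<Union>j\<in>{..J n'}. cball (dense_seq j :: 'a) (1 / (real n' + 1)))" (is "compact ?S")
  unfolding compact_eq_totally_bounded complete_eq_closed
proof
  show "closed ?S" by (intro closed_INT ballI closed_UN) auto
  show "\<forall>e>0. \<exists>k. finite k \<and> ?S \<subseteq> (\<Union>x\<in>k. ball x e)"
  proof (intro allI impI)
    fix e :: real assume "e > 0"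
    then obtain k where k: "1 / real (Suc k) < e" using nat_approx_posE by blast
    define n' where "n' = Suc (n + k)"
    have "1 / (real n' + 1) \<le> 1 / real (Suc k)" unfolding n'_def by (intro divide_left_mono) auto
    hence cb: "cball x (1 / (real n' + 1)) \<subseteq> ball x e" for x :: 'a using k by (auto simp del: of_nat_Suc)
    have "?S \<subseteq> (\<Union>j\<in>{..J n'}. cball (dense_seq j) (1 / (real n' + 1)))"
      by (rule INT_lower) (simp add: n'_def)
    also have "\<dots> \<subseteq> (\<Union>j\<in>{..J n'}. ball (dense_seq j) e)" by (intro UN_mono order_refl cb)
    also have "\<dots> = (\<Union>x\<in>dense_seq ` {..J n'}. ball x e)" by simp
    finally show "\<exists>k. finite k \<and> ?S \<subseteq> (\<Union>x\<in>k. ball x e)"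
      by (intro exI[of _ "dense_seq ` {..J n'}"] conjI finite_imageI finite_atMost)
  qed
qed

text \<open>Shell \<open>n\<close> lies in the ball of radius \<open>n + 1\<close>, which bounds
  \<open>c n\<close>. An atom of it missing all the closed balls for some \<open>n'\<close> would
  lie in \<open>outer z (J n') n'\<close>, whose count is 0; closed balls replace the open ones of
  \<open>outer\<close> so that the confining set is closed.\<close>

lemma tight_set_atomic:
  fixes z :: "'a::polish_space"
  assumes \<xi>: "atomic c x \<in> tight_set z M J"
    and x: "\<And>n i. i < c n \<Longrightarrow> real n \<le> dist z (x (n, i)) \<and> dist z (x (n, i)) < real n + 1"
  shows "c n \<le> M (Suc n)"
    "i < c n \<Longrightarrow> x (n, i) \<in> (\<Inter>n'\<in>{n<..}. \<Union>j\<in>{..J n'}. cball (dense_seq j) (1 / (real n' + 1)))"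
proof -
  have bf: "bf_counting (atomic c x)" using \<xi> by (simp add: tight_set_def)
  \<comment> \<open>\<open>T\<close> consists of index pairs rather than points, so coinciding atoms
    count with multiplicity.\<close>
  have le: "card T \<le> cnt (atomic c x) A" if A: "A \<in> sets borel" "bounded A"
    and T: "T \<subseteq> {p \<in> (SIGMA n:UNIV. {..<c n}). x p \<in> A}" "finite T" for T A
  proof -
    have "of_nat (card T) = emeasure (count_space UNIV) T" using T by (simp add: emeasure_count_space)
    also have "\<dots> \<le> emeasure (count_space UNIV) {p \<in> (SIGMA n:UNIV. {..<c n}). x p \<in> A}"
      using T by (intro emeasure_mono) auto
    also have "\<dots> = of_nat (cnt (atomic c x) A)"
      using bf_countingD(1)[OF bf A] A by (simp add: emeasure_atomic)
    finally show ?thesis by (simp only: of_nat_le_iff)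
  qed
  have "card (Pair n ` {..<c n}) \<le> cnt (atomic c x) (ball z (real (Suc n)))"
    by (rule le) (use x in \<open>auto simp: add.commute\<close>)
  also have "\<dots> \<le> M (Suc n)" using \<xi> unfolding tight_set_def by blast
  finally show "c n \<le> M (Suc n)" by (subst (asm) card_image) (auto simp: inj_on_def)
  assume i: "i < c n"
  show "x (n, i) \<in> (\<Inter>n'\<in>{n<..}. \<Union>j\<in>{..J n'}. cball (dense_seq j) (1 / (real n' + 1)))"
  proof (rule INT_I, rule ccontr)
    fix n' assume n': "n' \<in> {n<..}" and no: "x (n, i) \<notin> (\<Union>j\<in>{..J n'}. cball (dense_seq j) (1 / (real n' + 1)))"
    have "dist z (x (n, i)) < real n'" using x[OF i] n' by simp
    hence "x (n, i) \<in> outer z (J n') n'" 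
    proof -
      have "x (n, i) \<notin> ball (dense_seq j) (1 / (real n' + 1))" if "j \<in> {..J n'}" for j
      proof
        assume "x (n, i) \<in> ball (dense_seq j) (1 / (real n' + 1))"
        hence "x (n, i) \<in> cball (dense_seq j) (1 / (real n' + 1))" by simp
        with no that show False by blast
      qed
      with \<open>dist z (x (n, i)) < real n'\<close> show ?thesis by (auto simp: outer_def)
    qed
    hence "card {(n, i)} \<le> cnt (atomic c x) (outer z (J n') n')"
      by (intro le outer_borel bounded_outer) (use i in auto)
    moreover have "cnt (atomic c x) (outer z (J n') n') = 0" using \<xi> by (auto simp: tight_set_def)
    ultimately show False by simp
  qed
qed

text \<open>Counts and positions of all atoms are made to converge simultaneously. Of the two bounds
  defining a shell only the lower one is carried along: the strict upper bound may become an
  equality in the limit, and the lower one already gives local finiteness.\<close>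

lemma tight_set_subseq:
  fixes \<xi> :: "nat \<Rightarrow> 'a::polish_space measure"
  assumes \<xi>: "\<And>j. \<xi> j \<in> tight_set z M J"
  obtains r C X c x where "strict_mono (r :: nat \<Rightarrow> nat)" "\<And>j. \<xi> j = atomic (C j) (X j)"
    "\<And>j n i. i < C j n \<Longrightarrow> real n \<le> dist z (X j (n, i))"
    "\<And>n i. i < c n \<Longrightarrow> real n \<le> dist z (x (n, i))"
    "\<And>n. \<forall>\<^sub>F j in sequentially. C (r j) n = c n"
    "\<And>n i. i < c n \<Longrightarrow> (\<lambda>j. X (r j) (n, i)) \<longlonglongrightarrow> x (n, i)"
proof -
  have "\<forall>j. \<exists>c x. \<xi> j = atomic c x \<and> (\<forall>n i. i < c n \<longrightarrow> real n \<le> dist z (x (n, i)) \<and> dist z (x (n, i)) < real n + 1)"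
    using \<xi> by (intro allI bf_counting_imp_atomic) (auto simp: tight_set_def)
  then obtain C X where CX: "\<And>j. \<xi> j = atomic (C j) (X j)"
    "\<And>j n i. i < C j n \<Longrightarrow> real n \<le> dist z (X j (n, i)) \<and> dist z (X j (n, i)) < real n + 1" by metis
  define S where "S n = (\<Inter>n'\<in>{n<..}. \<Union>j\<in>{..J n'}. cball (dense_seq j :: 'a) (1 / (real n' + 1)))" for n
  have at: "atomic (C j) (X j) \<in> tight_set z M J" for j using \<xi>[of j] CX(1)[of j] by simp
  have CM: "C j n \<le> M (Suc n)" for j n by (rule tight_set_atomic(1)[OF at CX(2)])
  have XS: "i < C j n \<Longrightarrow> X j (n, i) \<in> S n" for j n i
    unfolding S_def by (rule tight_set_atomic(2)[OF at CX(2)])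
  \<comment> \<open>The point \<open>z\<close> stands in for an absent atom, so that every
    coordinate stays in a fixed compact set; the second component records the number of atoms in the
    shell.\<close>
  define y where "y j p = (if snd p < C j (fst p) then X j p else z, real (C j (fst p)))" for j and p :: "nat \<times> nat"
  have "\<exists>r. strict_mono (r :: nat \<Rightarrow> nat) \<and> (\<forall>p. convergent (\<lambda>j. y (r j) p))"
  proof (rule diagonal_convergent)
    show "compact (insert z (S (fst p)) \<times> {0..real (M (Suc (fst p)))})" for p :: "nat \<times> nat"
      unfolding S_def by (intro compact_Times compact_insert compact_inner) auto
    show "y j p \<in> insert z (S (fst p)) \<times> {0..real (M (Suc (fst p)))}" for j p
      using CM XS[of "snd p" j "fst p"] by (auto simp: y_def)
  qed
  then obtain r where r: "strict_mono (r :: nat \<Rightarrow> nat)" "\<And>p. convergent (\<lambda>j. y (r j) p)" by blast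
  then obtain l where l: "\<And>p. (\<lambda>j. y (r j) p) \<longlonglongrightarrow> l p" unfolding convergent_def by metis
  \<comment> \<open>Rounding the limit to the nearest integer: an integer at distance less than 1/2
    from the limit equals this value. The second component of \<open>y\<close> depends on the shell
    alone, so it is read at index 0.\<close>
  define c where "c n = nat \<lfloor>snd (l (n, 0)) + 1/2\<rfloor>" for n
  define x where "x p = fst (l p)" for p
  have c: "\<forall>\<^sub>F j in sequentially. C (r j) n = c n" for n
  proof -
    have "(\<lambda>j. real (C (r j) n)) \<longlonglongrightarrow> snd (l (n, 0))" using tendsto_snd[OF l[of "(n, 0)"]] by (simp add: y_def)
    hence "\<forall>\<^sub>F j in sequentially. dist (real (C (r j) n)) (snd (l (n, 0))) < 1/2" by (rule tendstoD) simp
    thus ?thesis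
    proof eventually_elim
      case (elim j)
      hence "real (C (r j) n) \<le> snd (l (n, 0)) + 1/2" "snd (l (n, 0)) + 1/2 < real (C (r j) n) + 1"
        unfolding dist_real_def by linarith+
      hence "\<lfloor>snd (l (n, 0)) + 1/2\<rfloor> = int (C (r j) n)" by (intro floor_unique) auto
      thus ?case by (simp add: c_def)
    qed
  qed
  have xl: "(\<lambda>j. X (r j) (n, i)) \<longlonglongrightarrow> x (n, i)" if i: "i < c n" for n i
  proof -
    have "(\<lambda>j. fst (y (r j) (n, i))) \<longlonglongrightarrow> x (n, i)" unfolding x_def by (intro tendsto_fst l)
    thus ?thesis
    proof (rule Lim_transform_eventually)
      show "\<forall>\<^sub>F j in sequentially. fst (y (r j) (n, i)) = X (r j) (n, i)"
        using c[of n] by eventually_elim (use i in \<open>simp add: y_def\<close>)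
    qed
  qed
  have x: "real n \<le> dist z (x (n, i))" if i: "i < c n" for n i
  proof (rule tendsto_lowerbound)
    show "(\<lambda>j. dist z (X (r j) (n, i))) \<longlonglongrightarrow> dist z (x (n, i))" by (intro tendsto_intros xl i)
    show "\<forall>\<^sub>F j in sequentially. real n \<le> dist z (X (r j) (n, i))"
      using c[of n] by eventually_elim (use i CX(2) in auto)
  qed simp
  show thesis by (rule that[OF r(1) CX(1) conjunct1[OF CX(2)] x c xl])
qed

text \<open>A failure at every level \<open>m\<close> supplies a configuration for each level, so
  the level tends to infinity along with the extracted subsequence. By \<open>snap_tendsto\<close>
  the configurations and their discretizations have the same limit, and continuity of
  \<open>F\<close> at that one limit contradicts the gap \<open>e\<close>.\<close>

lemma disc_uniform:
  fixes F :: "'a::polish_space measure \<Rightarrow> real"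
  assumes F: "wsharp_continuous F" and e: "e > 0"
  shows "\<exists>m. \<forall>\<xi>\<in>tight_set z M J. \<bar>F (disc m \<xi>) - F \<xi>\<bar> < e"
proof (rule ccontr)
  assume "\<not> (\<exists>m. \<forall>\<xi>\<in>tight_set z M J. \<bar>F (disc m \<xi>) - F \<xi>\<bar> < e)"
  hence "\<forall>m. \<exists>\<xi>. \<xi> \<in> tight_set z M J \<and> \<not> \<bar>F (disc m \<xi>) - F \<xi>\<bar> < e" by blast
  then obtain \<xi> where \<xi>: "\<And>m. \<xi> m \<in> tight_set z M J" "\<And>m. \<not> \<bar>F (disc m (\<xi> m)) - F (\<xi> m)\<bar> < e" by metis
  have bf: "bf_counting (\<xi> m)" for m using \<xi>(1)[of m] by (simp add: tight_set_def)
  obtain r C X c x where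
    r: "strict_mono (r :: nat \<Rightarrow> nat)" and CX: "\<And>j. \<xi> j = atomic (C j) (X j)" "\<And>j n i. i < C j n \<Longrightarrow> real n \<le> dist z (X j (n, i))"
    and x: "\<And>n i. i < c n \<Longrightarrow> real n \<le> dist z (x (n, i))"
    and c: "\<And>n. \<forall>\<^sub>F j in sequentially. C (r j) n = c n"
    and xl: "\<And>n i. i < c n \<Longrightarrow> (\<lambda>j. X (r j) (n, i)) \<longlonglongrightarrow> x (n, i)"
    by (rule tight_set_subseq[of \<xi>, OF \<xi>(1)]) (rule that; assumption)
  have rl: "filterlim r at_top sequentially" using r by (rule filterlim_subseq)
  have bl: "bf_counting (atomic c x)"
  proof (rule bf_counting_atomic[of _ z])
    fix R :: real
    show "finite {p \<in> (SIGMA n:UNIV. {..<c n}). dist z (x p) \<le> R}"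
    proof (rule finite_subset)
      show "{p \<in> (SIGMA n:UNIV. {..<c n}). dist z (x p) \<le> R} \<subseteq> (SIGMA n:{..nat \<lceil>R\<rceil>}. {..<c n})"
      proof
        fix p assume p: "p \<in> {p \<in> (SIGMA n:UNIV. {..<c n}). dist z (x p) \<le> R}"
        obtain n i where ni: "p = (n, i)" by (cases p)
        with p have i: "i < c n" "dist z (x (n, i)) \<le> R" by auto
        hence "real n \<le> R" using x[of i n] by simp
        hence "n \<le> nat \<lceil>R\<rceil>" by linarith
        thus "p \<in> (SIGMA n:{..nat \<lceil>R\<rceil>}. {..<c n})" using i ni by simp
      qed
    qed auto
  qed
  \<comment> \<open>Over finitely many shells the ranges of summation are eventually those of the
    limit, so termwise convergence suffices.\<close>
  have conv: "(\<lambda>j. \<Sum>n<R. \<Sum>i<C (r j) n. g j (X (r j) (n, i))) \<longlonglongrightarrow> (\<Sum>n<R. \<Sum>i<c n. f (x (n, i)))"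
    if g: "\<And>n i. i < c n \<Longrightarrow> (\<lambda>j. g j (X (r j) (n, i))) \<longlonglongrightarrow> f (x (n, i))" for R :: nat and g and f :: "'a \<Rightarrow> real"
  proof -
    have "(\<lambda>j. \<Sum>n<R. \<Sum>i<c n. g j (X (r j) (n, i))) \<longlonglongrightarrow> (\<Sum>n<R. \<Sum>i<c n. f (x (n, i)))"
      by (intro tendsto_sum g) auto
    thus ?thesis
    proof (rule Lim_transform_eventually)
      have "\<forall>\<^sub>F j in sequentially. \<forall>n\<in>{..<R}. C (r j) n = c n" using c by (intro eventually_ball_finite) auto
      thus "\<forall>\<^sub>F j in sequentially. (\<Sum>n<R. \<Sum>i<c n. g j (X (r j) (n, i))) = (\<Sum>n<R. \<Sum>i<C (r j) n. g j (X (r j) (n, i)))"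
        by eventually_elim simp
    qed
  qed
  have w: "(\<lambda>j. integral\<^sup>L (\<xi> (r j)) f) \<longlonglongrightarrow> integral\<^sup>L (atomic c x) f"
    "(\<lambda>j. integral\<^sup>L (disc (r j) (\<xi> (r j))) f) \<longlonglongrightarrow> integral\<^sup>L (atomic c x) f"
    if f: "continuous_on UNIV f" "bounded {x. f x \<noteq> 0}" for f :: "'a \<Rightarrow> real"
  proof -
    have fm [measurable]: "f \<in> borel_measurable borel" using f by (simp add: borel_measurable_continuous_onI)
    obtain B where B: "\<And>y. f y \<noteq> 0 \<Longrightarrow> dist z y \<le> B" using f(2) bounded_any_center[of "{x. f x \<noteq> 0}" z] by auto
    define R where "R = nat \<lceil>B\<rceil> + 1"
    have "B < real R" unfolding R_def by linarith
    hence R: "dist z y < real R" if "f y \<noteq> 0" for y using B[OF that] by simp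
    \<comment> \<open>One shell beyond the support of \<open>f\<close> is included because of the
      widening in \<open>snap_eq_0\<close>.\<close>
    have fR: "f w = 0" "snap m f w = 0" if "real n \<le> dist z w" "Suc R \<le> n" for w n m
    proof -
      have "real R + 1 \<le> dist z w" using that by linarith
      thus "snap m f w = 0" "f w = 0" using R[of w] by (auto intro: snap_eq_0[OF R])
    qed
    have lim: "integral\<^sup>L (atomic c x) f = (\<Sum>n<Suc R. \<Sum>i<c n. f (x (n, i)))"
      by (rule integral_atomic[OF fm], rule fR(1)[OF x])
    have e1: "integral\<^sup>L (\<xi> (r j)) f = (\<Sum>n<Suc R. \<Sum>i<C (r j) n. f (X (r j) (n, i)))" for j
      unfolding CX(1) by (rule integral_atomic[OF fm], rule fR(1)[OF CX(2)])
    have t1: "(\<lambda>j. f (X (r j) (n, i))) \<longlonglongrightarrow> f (x (n, i))" if "i < c n" for n i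
      using continuous_on_tendsto_compose[OF f(1) xl[OF that]] by simp
    show "(\<lambda>j. integral\<^sup>L (\<xi> (r j)) f) \<longlonglongrightarrow> integral\<^sup>L (atomic c x) f"
      unfolding lim e1 by (rule conv, rule t1)
    have e2: "integral\<^sup>L (disc (r j) (\<xi> (r j))) f = (\<Sum>n<Suc R. \<Sum>i<C (r j) n. snap (r j) f (X (r j) (n, i)))" for j
    proof -
      have "integral\<^sup>L (disc (r j) (\<xi> (r j))) f = integral\<^sup>L (\<xi> (r j)) (snap (r j) f)"
        by (rule integral_disc[OF bf fm])
      also have "\<dots> = (\<Sum>n<Suc R. \<Sum>i<C (r j) n. snap (r j) f (X (r j) (n, i)))"
        unfolding CX(1) by (rule integral_atomic[OF borel_measurable_snap], rule fR(2)[OF CX(2)])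
      finally show ?thesis .
    qed
    have t2: "(\<lambda>j. snap (r j) f (X (r j) (n, i))) \<longlonglongrightarrow> f (x (n, i))" if "i < c n" for n i
      by (rule snap_tendsto[OF f(1) xl[OF that] rl])
    show "(\<lambda>j. integral\<^sup>L (disc (r j) (\<xi> (r j))) f) \<longlonglongrightarrow> integral\<^sup>L (atomic c x) f"
      unfolding lim e2 by (rule conv, rule t2)
  qed
  have "wsharp_conv (\<lambda>j. \<xi> (r j)) (atomic c x)" "wsharp_conv (\<lambda>j. disc (r j) (\<xi> (r j))) (atomic c x)"
    unfolding wsharp_conv_def by (intro allI impI w; elim conjE; assumption)+
  note wc = this
  have FD: "(\<lambda>j. F (\<eta> j)) \<longlonglongrightarrow> F (atomic c x)"
    if "\<And>j. bf_counting (\<eta> j)" "wsharp_conv \<eta> (atomic c x)" for \<eta>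
    using F[unfolded wsharp_continuous_def, rule_format, of \<eta> "atomic c x"] bl that by blast
  have "(\<lambda>j. F (\<xi> (r j))) \<longlonglongrightarrow> F (atomic c x)" "(\<lambda>j. F (disc (r j) (\<xi> (r j)))) \<longlonglongrightarrow> F (atomic c x)"
    by (rule FD[OF bf wc(1)], rule FD[OF bf_counting_disc wc(2)])
  from tendsto_diff[OF this(2,1)] have "(\<lambda>j. F (disc (r j) (\<xi> (r j))) - F (\<xi> (r j))) \<longlonglongrightarrow> 0" by simp
  from eventually_happens'[OF _ tendstoD[OF this e]]
  obtain j where "dist (F (disc (r j) (\<xi> (r j))) - F (\<xi> (r j))) 0 < e" by (metis trivial_limit_sequentially)
  hence "\<bar>F (disc (r j) (\<xi> (r j))) - F (\<xi> (r j))\<bar> < e" unfolding dist_real_def diff_0_right .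
  with \<xi>(2)[of "r j"] show False by (rule notE)
qed

section \<open>Uniform tail estimates\<close>

text \<open>A Dini-type argument. Choose \<open>J0\<close> with \<open>h J0 < e\<close>; convergence
  in \<open>k\<close> at this single \<open>J0\<close> covers all \<open>k \<ge> k0\<close>,
  monotonicity in \<open>J\<close> preserves the bound, and the finitely many smaller
  \<open>k\<close> are covered by their own limits.\<close>

lemma uniform_small:
  fixes g :: "nat \<Rightarrow> nat \<Rightarrow> real"
  assumes g: "\<And>k. k \<ge> 1 \<Longrightarrow> antimono (g k)" "\<And>k. k \<ge> 1 \<Longrightarrow> g k \<longlonglongrightarrow> 0"
    and h: "h \<longlonglongrightarrow> 0" and gh: "\<And>J. (\<lambda>k. g k J) \<longlonglongrightarrow> h J" and e: "e > 0"
  shows "\<exists>J. (\<forall>k\<ge>1. g k J \<le> e) \<and> h J \<le> e"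
proof -
  obtain J0 where "h J0 < e" using order_tendstoD(2)[OF h e] by (auto simp: eventually_sequentially)
  then obtain k0 where k0: "\<And>k. k \<ge> k0 \<Longrightarrow> g k J0 < e"
    using order_tendstoD(2)[OF gh \<open>h J0 < e\<close>] unfolding eventually_sequentially by blast
  have "\<forall>\<^sub>F J in sequentially. \<forall>k\<in>{1..<k0}. g k J < e"
    using order_tendstoD(2)[OF g(2) e] by (intro eventually_ball_finite) auto
  moreover have "\<forall>\<^sub>F J in sequentially. h J < e" by (rule order_tendstoD(2)[OF h e])
  ultimately have "\<forall>\<^sub>F J in sequentially. (\<forall>k\<in>{1..<k0}. g k J < e) \<and> h J < e \<and> J0 \<le> J"
    using eventually_ge_at_top[of J0] by eventually_elim auto
  then obtain J where J: "\<forall>k\<in>{1..<k0}. g k J < e" "h J < e" "J0 \<le> J"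
    using eventually_happens'[OF trivial_limit_sequentially] by blast
  have "g k J \<le> e" if k: "k \<ge> 1" for k
  proof (cases "k < k0")
    case True thus ?thesis using J k by (simp add: less_imp_le)
  next
    case False
    have "g k J \<le> g k J0" using g(1)[OF k] J(3) by (rule antimonoD)
    thus ?thesis using k0[of k] False by simp
  qed
  with J show ?thesis by (intro exI[of _ J]) auto
qed

lemma tendsto_by_approximation:
  fixes x :: "nat \<Rightarrow> real"
  assumes "\<And>e. e > 0 \<Longrightarrow> \<exists>a l. a \<longlonglongrightarrow> l \<and> (\<forall>k\<ge>1. \<bar>x k - a k\<bar> \<le> e) \<and> \<bar>y - l\<bar> \<le> e"
  shows "x \<longlonglongrightarrow> y"
proof (rule tendstoI)
  fix e :: real assume "e > 0"
  then obtain a l where al: "a \<longlonglongrightarrow> l" "\<And>k. k \<ge> 1 \<Longrightarrow> \<bar>x k - a k\<bar> \<le> e / 4" "\<bar>y - l\<bar> \<le> e / 4"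
    using assms[of "e / 4"] by auto
  have "\<forall>\<^sub>F k in sequentially. dist (a k) l < e / 4" using al(1) \<open>e > 0\<close> by (intro tendstoD) auto
  thus "\<forall>\<^sub>F k in sequentially. dist (x k) y < e"
    using eventually_ge_at_top[of 1]
  proof eventually_elim
    case (elim k)
    thus ?case using al(2)[of k] al(3) \<open>e > 0\<close> unfolding dist_real_def by linarith
  qed
qed

lemma integral_diff_le:
  fixes f g :: "'w \<Rightarrow> real"
  assumes "prob_space M" and [measurable]: "f \<in> borel_measurable M" "g \<in> borel_measurable M" "E \<in> sets M"
    and B: "\<And>\<omega>. \<bar>f \<omega>\<bar> \<le> B" "\<And>\<omega>. \<bar>g \<omega>\<bar> \<le> B" and d: "d \<ge> 0"
    and E: "measure M E \<le> e" "\<And>\<omega>. \<omega> \<in> space M \<Longrightarrow> \<omega> \<notin> E \<Longrightarrow> \<bar>f \<omega> - g \<omega>\<bar> \<le> d"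
  shows "\<bar>(\<integral>\<omega>. f \<omega> \<partial>M) - (\<integral>\<omega>. g \<omega> \<partial>M)\<bar> \<le> d + 2 * B * e"
proof -
  interpret prob_space M by fact
  have B0: "B \<ge> 0" using B(1)[of undefined] by linarith
  have int: "integrable M f" "integrable M g" by (rule integrable_const_bound[of _ B]; use B in auto)+
  have int': "integrable M (\<lambda>\<omega>. d + 2 * B * indicator E \<omega>)" by (intro Bochner_Integration.integrable_add integrable_mult_right) (auto simp: less_top[symmetric])
  have "\<bar>(\<integral>\<omega>. f \<omega> \<partial>M) - (\<integral>\<omega>. g \<omega> \<partial>M)\<bar> = \<bar>\<integral>\<omega>. f \<omega> - g \<omega> \<partial>M\<bar>"
    using int by simp
  also have "\<dots> \<le> (\<integral>\<omega>. d + 2 * B * indicator E \<omega> \<partial>M)"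
  proof (rule order_trans[OF integral_abs_bound integral_mono])
    show "integrable M (\<lambda>\<omega>. \<bar>f \<omega> - g \<omega>\<bar>)" using int by simp
    fix \<omega> assume "\<omega> \<in> space M"
    show "\<bar>f \<omega> - g \<omega>\<bar> \<le> d + 2 * B * indicator E \<omega>"
    proof (cases "\<omega> \<in> E")
      case True
      have "\<bar>f \<omega> - g \<omega>\<bar> \<le> 2 * B" using B(1)[of \<omega>] B(2)[of \<omega>] by linarith
      with True d show ?thesis by simp
    qed (use E(2) \<open>\<omega> \<in> space M\<close> in simp)
  qed (rule int')
  also have "\<dots> = d + 2 * B * measure M E" 
    by (subst Bochner_Integration.integral_add) (auto simp: prob_space less_top[symmetric])
  also have "\<dots> \<le> d + 2 * B * e" using E(1) B0 by (intro add_left_mono mult_left_mono) auto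
  finally show ?thesis .
qed

lemma prob_in_finite:
  assumes "prob_space M" and V[measurable]: "V \<in> measurable M (count_space UNIV)" and S: "finite S"
  shows "measure M {\<omega>\<in>space M. V \<omega> \<in> S} = (\<Sum>s\<in>S. measure M {\<omega>\<in>space M. V \<omega> = s})"
proof -
  interpret prob_space M by fact
  have "measure M (\<Union>s\<in>S. {\<omega>\<in>space M. V \<omega> = s}) = (\<Sum>s\<in>S. measure M {\<omega>\<in>space M. V \<omega> = s})"
    using S by (intro finite_measure_finite_Union) (auto simp: disjoint_family_on_def)
  also have "(\<Union>s\<in>S. {\<omega>\<in>space M. V \<omega> = s}) = {\<omega>\<in>space M. V \<omega> \<in> S}" by auto
  finally show ?thesis .
qed

text \<open>As \<open>h\<close> is injective, finitely many states satisfy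
  \<open>h s \<le> J\<close>, so a tail is 1 minus a finite sum of point probabilities and converges
  in \<open>k\<close>. No mass escapes because the limits are the point probabilities of a
  probability law.\<close>

lemma tail_uniform:
  fixes V :: "nat \<Rightarrow> 'w \<Rightarrow> 's" and W :: "'v \<Rightarrow> 's" and h :: "'s \<Rightarrow> nat"
  assumes P: "\<And>k. k \<ge> 1 \<Longrightarrow> prob_space (P k)" "prob_space Q"
    and V: "\<And>k. k \<ge> 1 \<Longrightarrow> V k \<in> measurable (P k) (count_space UNIV)" "W \<in> measurable Q (count_space UNIV)"
    and conv: "\<And>s. (\<lambda>k. measure (P k) {\<omega>\<in>space (P k). V k \<omega> = s}) \<longlonglongrightarrow> measure Q {\<omega>\<in>space Q. W \<omega> = s}"
    and h: "inj h" and e: "e > 0"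
  shows "\<exists>J. (\<forall>k\<ge>1. measure (P k) {\<omega>\<in>space (P k). h (V k \<omega>) > J} \<le> e) \<and> measure Q {\<omega>\<in>space Q. h (W \<omega>) > J} \<le> e"
proof (rule uniform_small[OF _ _ _ _ e])
  have anti: "antimono (\<lambda>J. measure M {\<omega>\<in>space M. h (U \<omega>) > J})"
    and lim: "(\<lambda>J. measure M {\<omega>\<in>space M. h (U \<omega>) > J}) \<longlonglongrightarrow> 0"
    and eq: "\<And>J. measure M {\<omega>\<in>space M. h (U \<omega>) > J} = 1 - (\<Sum>s | h s \<le> J. measure M {\<omega>\<in>space M. U \<omega> = s})"
    if "prob_space M" and [measurable]: "U \<in> measurable M (count_space UNIV)" for M :: "'x measure" and U
  proof -
    interpret prob_space M by fact
    have [measurable]: "{\<omega>\<in>space M. h (U \<omega>) > J} \<in> sets M" for J by measurable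
    show "antimono (\<lambda>J. measure M {\<omega>\<in>space M. h (U \<omega>) > J})"
      by (intro antimonoI finite_measure_mono) auto
    have "(\<lambda>J. measure M {\<omega>\<in>space M. h (U \<omega>) > J}) \<longlonglongrightarrow> measure M (\<Inter>J. {\<omega>\<in>space M. h (U \<omega>) > J})"
      by (intro finite_Lim_measure_decseq) (auto simp: decseq_def)
    also have "(\<Inter>J. {\<omega>\<in>space M. h (U \<omega>) > J}) = {}" by auto
    finally show "(\<lambda>J. measure M {\<omega>\<in>space M. h (U \<omega>) > J}) \<longlonglongrightarrow> 0" by simp
    fix J
    have "finite (h -` {..J})" using h by (intro finite_vimageI) auto
    hence fin: "finite {s. h s \<le> J}" by (simp add: vimage_def)
    have "{\<omega>\<in>space M. h (U \<omega>) > J} = space M - {\<omega>\<in>space M. U \<omega> \<in> {s. h s \<le> J}}" by auto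
    hence "measure M {\<omega>\<in>space M. h (U \<omega>) > J} = 1 - measure M {\<omega>\<in>space M. U \<omega> \<in> {s. h s \<le> J}}"
      by (simp only:) (rule prob_compl, measurable)
    thus "measure M {\<omega>\<in>space M. h (U \<omega>) > J} = 1 - (\<Sum>s | h s \<le> J. measure M {\<omega>\<in>space M. U \<omega> = s})"
      using prob_in_finite[OF that fin] by simp
  qed
  show "antimono (\<lambda>J. measure (P k) {\<omega>\<in>space (P k). h (V k \<omega>) > J})" if "k \<ge> 1" for k using anti P V that by blast
  show "(\<lambda>J. measure (P k) {\<omega>\<in>space (P k). h (V k \<omega>) > J}) \<longlonglongrightarrow> 0" if "k \<ge> 1" for k using lim P V that by blast
  show "(\<lambda>J. measure Q {\<omega>\<in>space Q. h (W \<omega>) > J}) \<longlonglongrightarrow> 0" using lim P V by blast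
  fix J
  have "(\<lambda>k. 1 - (\<Sum>s | h s \<le> J. measure (P k) {\<omega>\<in>space (P k). V k \<omega> = s})) \<longlonglongrightarrow> 1 - (\<Sum>s | h s \<le> J. measure Q {\<omega>\<in>space Q. W \<omega> = s})"
    by (intro tendsto_intros conv)
  hence "(\<lambda>k. 1 - (\<Sum>s | h s \<le> J. measure (P k) {\<omega>\<in>space (P k). V k \<omega> = s})) \<longlonglongrightarrow> measure Q {\<omega>\<in>space Q. h (W \<omega>) > J}"
    using eq[OF P(2) V(2)] by simp
  thus "(\<lambda>k. measure (P k) {\<omega>\<in>space (P k). h (V k \<omega>) > J}) \<longlonglongrightarrow> measure Q {\<omega>\<in>space Q. h (W \<omega>) > J}"
  proof (rule Lim_transform_eventually)
    show "\<forall>\<^sub>F k in sequentially. 1 - (\<Sum>s | h s \<le> J. measure (P k) {\<omega>\<in>space (P k). V k \<omega> = s}) = measure (P k) {\<omega>\<in>space (P k). h (V k \<omega>) > J}"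
      using eventually_ge_at_top[of 1] by eventually_elim (simp add: eq[OF P(1) V(1)])
  qed
qed

text \<open>Outside a finite set of states, chosen for all \<open>k\<close> at once, the mass is
  small; on that set the expectation is a finite sum of convergent terms.\<close>

lemma discrete_conv_integral:
  fixes V :: "nat \<Rightarrow> 'w \<Rightarrow> 's::countable" and W :: "'v \<Rightarrow> 's" and G :: "'s \<Rightarrow> real"
  assumes P: "\<And>k. k \<ge> 1 \<Longrightarrow> prob_space (P k)" "prob_space Q"
    and V: "\<And>k. k \<ge> 1 \<Longrightarrow> V k \<in> measurable (P k) (count_space UNIV)" "W \<in> measurable Q (count_space UNIV)"
    and conv: "\<And>s. (\<lambda>k. measure (P k) {\<omega>\<in>space (P k). V k \<omega> = s}) \<longlonglongrightarrow> measure Q {\<omega>\<in>space Q. W \<omega> = s}"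
    and B: "\<And>s. \<bar>G s\<bar> \<le> B"
  shows "(\<lambda>k. \<integral>\<omega>. G (V k \<omega>) \<partial>P k) \<longlonglongrightarrow> (\<integral>\<omega>. G (W \<omega>) \<partial>Q)"
proof (rule tendsto_by_approximation)
  fix e :: real assume e: "e > 0"
  have B0: "B \<ge> 0" using B[of undefined] by linarith
  \<comment> \<open>Truncation changes the integrand by at most \<open>2 * B\<close>, and only
    beyond \<open>J\<close>; the summand 1 keeps the quotient meaningful when
    \<open>B = 0\<close>.\<close>
  define e1 where "e1 = e / (2 * B + 1)"
  have e1: "e1 > 0" "2 * B * e1 \<le> e" using e B0 by (auto simp: e1_def field_simps)
  obtain J where J: "\<And>k. k \<ge> 1 \<Longrightarrow> measure (P k) {\<omega>\<in>space (P k). to_nat (V k \<omega>) > J} \<le> e1"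
    "measure Q {\<omega>\<in>space Q. to_nat (W \<omega>) > J} \<le> e1"
    using tail_uniform[where h = to_nat, OF P V conv _ e1(1)] by auto
  have fin: "finite {s::'s. to_nat s \<le> J}"
  proof -
    have "finite (to_nat -` {..J} :: 's set)" by (intro finite_vimageI) auto
    thus ?thesis by (simp add: vimage_def)
  qed
  have app: "\<bar>(\<integral>\<omega>. G (U \<omega>) \<partial>M) - (\<Sum>s | to_nat s \<le> J. G s * measure M {\<omega>\<in>space M. U \<omega> = s})\<bar> \<le> e"
    if M: "prob_space M" and U[measurable]: "U \<in> measurable M (count_space UNIV)" and le: "measure M {\<omega>\<in>space M. to_nat (U \<omega>) > J} \<le> e1" for M :: "'x measure" and U
  proof -
    interpret prob_space M by fact
    define g where "g \<omega> = (if to_nat (U \<omega>) \<le> J then G (U \<omega>) else 0)" for \<omega>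
    have "(\<integral>\<omega>. g \<omega> \<partial>M) = (\<integral>\<omega>. (\<Sum>s | to_nat s \<le> J. G s * indicator {\<omega>\<in>space M. U \<omega> = s} \<omega>) \<partial>M)"
    proof (intro Bochner_Integration.integral_cong refl)
      fix \<omega> assume "\<omega> \<in> space M"
      thus "g \<omega> = (\<Sum>s | to_nat s \<le> J. G s * indicator {\<omega>\<in>space M. U \<omega> = s} \<omega>)"
        using fin by (simp add: g_def indicator_def of_bool_def if_distrib[of "\<lambda>x. _ * x"] sum.delta' cong: if_cong)
    qed
    also have "\<dots> = (\<Sum>s | to_nat s \<le> J. G s * measure M {\<omega>\<in>space M. U \<omega> = s})"
      by (subst Bochner_Integration.integral_sum) (auto simp: less_top[symmetric])
    finally have "(\<Sum>s | to_nat s \<le> J. G s * measure M {\<omega>\<in>space M. U \<omega> = s}) = (\<integral>\<omega>. g \<omega> \<partial>M)" ..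
    moreover have "\<bar>(\<integral>\<omega>. G (U \<omega>) \<partial>M) - (\<integral>\<omega>. g \<omega> \<partial>M)\<bar> \<le> 0 + 2 * B * e1"
    proof (rule integral_diff_le[OF M])
      show "g \<in> borel_measurable M" unfolding g_def[abs_def] by measurable
      show "measure M {\<omega>\<in>space M. to_nat (U \<omega>) > J} \<le> e1" by fact
    qed (use B B0 in \<open>auto simp: g_def\<close>)
    ultimately show ?thesis using e1 by simp
  qed
  show "\<exists>a l. a \<longlonglongrightarrow> l \<and> (\<forall>k\<ge>1. \<bar>(\<integral>\<omega>. G (V k \<omega>) \<partial>P k) - a k\<bar> \<le> e) \<and> \<bar>(\<integral>\<omega>. G (W \<omega>) \<partial>Q) - l\<bar> \<le> e"
  proof (intro exI conjI allI impI)
    show "(\<lambda>k. \<Sum>s | to_nat s \<le> J. G s * measure (P k) {\<omega>\<in>space (P k). V k \<omega> = s})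
       \<longlonglongrightarrow> (\<Sum>s | to_nat s \<le> J. G s * measure Q {\<omega>\<in>space Q. W \<omega> = s})"
      by (intro tendsto_intros conv)
    show "\<bar>(\<integral>\<omega>. G (V k \<omega>) \<partial>P k) - (\<Sum>s | to_nat s \<le> J. G s * measure (P k) {\<omega>\<in>space (P k). V k \<omega> = s})\<bar> \<le> e" if "k \<ge> 1" for k
      by (rule app[OF P(1)[OF that] V(1)[OF that] J(1)[OF that]])
    show "\<bar>(\<integral>\<omega>. G (W \<omega>) \<partial>Q) - (\<Sum>s | to_nat s \<le> J. G s * measure Q {\<omega>\<in>space Q. W \<omega> = s})\<bar> \<le> e"
      by (rule app[OF P(2) V(2) J(2)])
  qed
qed

section \<open>Weak convergence from finite-dimensional convergence\<close>

lemma measurable_cnt: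
  assumes "point_process M N" "A \<in> sets borel" "bounded A"
  shows "(\<lambda>\<omega>. cnt (N \<omega>) A) \<in> measurable M (count_space UNIV)"
proof -
  have [measurable]: "(\<lambda>\<omega>. emeasure (N \<omega>) A) \<in> borel_measurable M" using assms by (auto simp: point_process_def)
  show ?thesis unfolding cnt_def by measurable
qed

lemma emeasure_eq_cnt_iff:
  assumes "point_process M N" "\<omega> \<in> space M" "A \<in> sets borel" "bounded A"
  shows "emeasure (N \<omega>) A = of_nat n \<longleftrightarrow> cnt (N \<omega>) A = n"
  using bf_countingD(1)[of "N \<omega>" A] assms by (auto simp: point_process_def)

text \<open>A list rather than a function on the indices: lists of naturals form a countable type,
  so measurability and convergence in law reduce to single values.\<close>

definition cell_counts :: "nat \<Rightarrow> 'a::polish_space measure \<Rightarrow> nat list" where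
  "cell_counts m \<xi> = map (\<lambda>i. cnt \<xi> (cell m i)) [0..<Suc m]"

lemma disc_cell_counts: "disc m \<xi> = disc_of m (\<lambda>i. cell_counts m \<xi> ! i)"
proof -
  have "(if i \<le> m then cnt \<xi> (cell m i) else 0) = (if i \<le> m then cell_counts m \<xi> ! i else 0)" for i
    by (simp add: cell_counts_def nth_append less_Suc_eq_le del: upt_Suc)
  thus ?thesis unfolding disc_def disc_of_def by presburger
qed

lemma cell_counts_eq_iff:
  "cell_counts m \<xi> = s \<longleftrightarrow> length s = Suc m \<and> (\<forall>i<Suc m. cnt \<xi> (cell m i) = s ! i)"
  by (auto simp: cell_counts_def list_eq_iff_nth_eq simp del: upt_Suc)

lemma measurable_cell_counts:
  assumes "point_process M N"
  shows "(\<lambda>\<omega>. cell_counts m (N \<omega>)) \<in> measurable M (count_space UNIV)"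
proof (subst measurable_count_space_eq2_countable, simp, safe)
  fix s :: "nat list"
  have [measurable]: "(\<lambda>\<omega>. cnt (N \<omega>) (cell m i)) \<in> measurable M (count_space UNIV)" for i
    by (intro measurable_cnt assms cell_borel bounded_cell)
  have "(\<lambda>\<omega>. cell_counts m (N \<omega>)) -` {s} \<inter> space M
    = {\<omega>\<in>space M. length s = Suc m \<and> (\<forall>i\<in>{..<Suc m}. cnt (N \<omega>) (cell m i) = s ! i)}"
    by (rule set_eqI) (simp add: cell_counts_eq_iff Ball_def conj_commute)
  also have "\<dots> \<in> sets M" by measurable
  finally show "(\<lambda>\<omega>. cell_counts m (N \<omega>)) -` {s} \<inter> space M \<in> sets M" .
qed

text \<open>Convergence is required on all bounded Borel sets, so it applies to the cells and to the
  sets \<open>outer\<close> whatever mass sits on their boundaries. The index starts at 1 because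
  the Waring parameters \<open>c * k\<close> and \<open>k\<close> vanish at 0.\<close>

locale fidi_convergence =
  fixes P :: "nat \<Rightarrow> 'w measure" and Ns :: "nat \<Rightarrow> 'w \<Rightarrow> 'a::polish_space measure"
    and Q :: "'v measure" and N :: "'v \<Rightarrow> 'a measure"
  assumes pp: "k \<ge> 1 \<Longrightarrow> point_process (P k) (Ns k)" "point_process Q N"
    and fidi: "\<And>(l::nat) A xs. (\<And>i. i < l \<Longrightarrow> A i \<in> sets borel \<and> bounded (A i)) \<Longrightarrow> disjoint_family_on A {..<l} \<Longrightarrow>
      (\<lambda>k. measure (P k) {\<omega>\<in>space (P k). \<forall>i<l. emeasure (Ns k \<omega>) (A i) = of_nat (xs i)})
        \<longlonglongrightarrow> measure Q {\<omega>\<in>space Q. \<forall>i<l. emeasure (N \<omega>) (A i) = of_nat (xs i)}"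
begin

lemma ps: "k \<ge> 1 \<Longrightarrow> prob_space (P k)" "prob_space Q"
  using pp by (auto simp: point_process_def)

lemma fidi_cnt:
  fixes l :: nat
  assumes A: "\<And>i. i < l \<Longrightarrow> A i \<in> sets borel \<and> bounded (A i)" "disjoint_family_on A {..<l}"
  shows "(\<lambda>k. measure (P k) {\<omega>\<in>space (P k). \<forall>i<l. cnt (Ns k \<omega>) (A i) = xs i})
        \<longlonglongrightarrow> measure Q {\<omega>\<in>space Q. \<forall>i<l. cnt (N \<omega>) (A i) = xs i}"
proof -
  have eq: "{\<omega>\<in>space M. \<forall>i<l. emeasure (U \<omega>) (A i) = of_nat (xs i)} = {\<omega>\<in>space M. \<forall>i<l. cnt (U \<omega>) (A i) = xs i}"
    if "point_process M U" for M :: "'x measure" and U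
    using emeasure_eq_cnt_iff[OF that] A(1) by auto
  have "(\<lambda>k. measure (P k) {\<omega>\<in>space (P k). \<forall>i<l. emeasure (Ns k \<omega>) (A i) = of_nat (xs i)})
        \<longlonglongrightarrow> measure Q {\<omega>\<in>space Q. \<forall>i<l. cnt (N \<omega>) (A i) = xs i}"
    using fidi[of l A xs, OF A] unfolding eq[OF pp(2)] .
  thus ?thesis
  proof (rule Lim_transform_eventually)
    show "\<forall>\<^sub>F k in sequentially. measure (P k) {\<omega>\<in>space (P k). \<forall>i<l. emeasure (Ns k \<omega>) (A i) = of_nat (xs i)}
       = measure (P k) {\<omega>\<in>space (P k). \<forall>i<l. cnt (Ns k \<omega>) (A i) = xs i}"
      using eventually_ge_at_top[of 1] by eventually_elim (simp add: eq[OF pp(1)])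
  qed
qed

lemma cnt_conv:
  assumes "A \<in> sets borel" "bounded A"
  shows "(\<lambda>k. measure (P k) {\<omega>\<in>space (P k). cnt (Ns k \<omega>) A = n}) \<longlonglongrightarrow> measure Q {\<omega>\<in>space Q. cnt (N \<omega>) A = n}"
  using fidi_cnt[of 1 "\<lambda>_. A" "\<lambda>_. n"] assms by (simp add: disjoint_family_on_def)

lemma ball_tight:
  assumes "e > 0"
  shows "\<exists>M. (\<forall>k\<ge>1. measure (P k) {\<omega>\<in>space (P k). cnt (Ns k \<omega>) (ball z n) > M} \<le> e) \<and>
    measure Q {\<omega>\<in>space Q. cnt (N \<omega>) (ball z n) > M} \<le> e"
proof -
  have "\<exists>M. (\<forall>k\<ge>1. measure (P k) {\<omega>\<in>space (P k). id (cnt (Ns k \<omega>) (ball z n)) > M} \<le> e) \<and>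
    measure Q {\<omega>\<in>space Q. id (cnt (N \<omega>) (ball z n)) > M} \<le> e"
    by (rule tail_uniform[OF ps]) (assumption | rule measurable_cnt pp borel_open open_ball bounded_ball cnt_conv assms inj_on_id)+
  thus ?thesis by simp
qed

text \<open>For each process the events decrease to the empty event in \<open>J\<close>; for fixed
  \<open>J\<close> their probabilities are 1 minus the probability of count 0 and converge in
  \<open>k\<close>. \<open>uniform_small\<close> combines the two.\<close>

lemma outer_tight:
  assumes e: "e > 0"
  shows "\<exists>J. (\<forall>k\<ge>1. measure (P k) {\<omega>\<in>space (P k). cnt (Ns k \<omega>) (outer z J n) \<noteq> 0} \<le> e) \<and>
    measure Q {\<omega>\<in>space Q. cnt (N \<omega>) (outer z J n) \<noteq> 0} \<le> e"
proof (rule uniform_small[OF _ _ _ _ e])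
  have outer_mono: "outer z J' n \<subseteq> outer z J n" if "J \<le> J'" for J J'
    using that by (auto simp: outer_def)
  have outer_Inter: "(\<Inter>J. outer z J n) = {}"
  proof -
    have "\<exists>J. y \<notin> outer z J n" for y
    proof -
      obtain j where "dist (dense_seq j) y < 1 / (real n + 1)" using dense_seq_near[of "1 / (real n + 1)" y] by auto
      thus ?thesis by (intro exI[of _ j]) (auto simp: outer_def)
    qed
    thus ?thesis by blast
  qed
  have anti: "antimono (\<lambda>J. measure M {\<omega>\<in>space M. cnt (U \<omega>) (outer z J n) \<noteq> 0})"
    and lim: "(\<lambda>J. measure M {\<omega>\<in>space M. cnt (U \<omega>) (outer z J n) \<noteq> 0}) \<longlonglongrightarrow> 0"
    and eq: "\<And>J. measure M {\<omega>\<in>space M. cnt (U \<omega>) (outer z J n) \<noteq> 0} = 1 - measure M {\<omega>\<in>space M. cnt (U \<omega>) (outer z J n) = 0}"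
    if U: "point_process M U" for M :: "'x measure" and U
  proof -
    interpret prob_space M using U by (simp add: point_process_def)
    have [measurable]: "(\<lambda>\<omega>. cnt (U \<omega>) (outer z J n)) \<in> measurable M (count_space UNIV)" for J
      by (intro measurable_cnt[OF U] outer_borel bounded_outer)
    define E where "E J = {\<omega>\<in>space M. cnt (U \<omega>) (outer z J n) \<noteq> 0}" for J
    have Em: "E J \<in> sets M" for J unfolding E_def by measurable
    have bfU: "bf_counting (U \<omega>)" if "\<omega> \<in> space M" for \<omega> using U that by (simp add: point_process_def)
    have cc: "emeasure (U \<omega>) (outer z J n) = of_nat (cnt (U \<omega>) (outer z J n))" "sets (U \<omega>) = sets borel" if "\<omega> \<in> space M" for \<omega> J
      using bf_countingD(1)[OF bfU[OF that] outer_borel bounded_outer] bfU[OF that] by (simp_all add: bf_counting_def)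
    have "cnt (U \<omega>) (outer z J' n) \<le> cnt (U \<omega>) (outer z J n)" if "J \<le> J'" "\<omega> \<in> space M" for J J' \<omega>
    proof -
      have "emeasure (U \<omega>) (outer z J' n) \<le> emeasure (U \<omega>) (outer z J n)"
        using outer_mono[OF that(1)] cc(2)[OF that(2)] by (intro emeasure_mono) auto
      thus ?thesis unfolding cc(1)[OF that(2)] by (simp only: of_nat_le_iff)
    qed
    hence Eanti: "E J' \<subseteq> E J" if "J \<le> J'" for J J' using that by (fastforce simp: E_def)
    \<comment> \<open>Continuity from above inside a single configuration: integer counts that never
      reach 0 would leave mass at least 1 on the empty intersection.\<close>
    have EI: "(\<Inter>J. E J) = {}"
    proof (rule ccontr)
      assume "(\<Inter>J. E J) \<noteq> {}"
      then obtain \<omega> where \<omega>: "\<omega> \<in> space M" "\<And>J. cnt (U \<omega>) (outer z J n) \<noteq> 0" by (auto simp: E_def)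
      have "(\<lambda>J. emeasure (U \<omega>) (outer z J n)) \<longlonglongrightarrow> emeasure (U \<omega>) (\<Inter>J. outer z J n)"
        by (rule Lim_emeasure_decseq) (use cc[OF \<omega>(1)] outer_mono in \<open>auto simp: decseq_def\<close>)
      moreover have "1 \<le> emeasure (U \<omega>) (outer z J n)" for J
        unfolding cc(1)[OF \<omega>(1)] using \<omega>(2)[of J] by (cases "cnt (U \<omega>) (outer z J n)") auto
      ultimately have "1 \<le> emeasure (U \<omega>) (\<Inter>J. outer z J n)" by (intro tendsto_lowerbound) auto
      thus False by (simp add: outer_Inter)
    qed
    show "antimono (\<lambda>J. measure M {\<omega>\<in>space M. cnt (U \<omega>) (outer z J n) \<noteq> 0})"
      unfolding E_def[symmetric] by (intro antimonoI finite_measure_mono Eanti Em)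
    have "(\<lambda>J. measure M (E J)) \<longlonglongrightarrow> measure M (\<Inter>J. E J)"
      using Em Eanti by (intro finite_Lim_measure_decseq) (auto simp: decseq_def)
    thus "(\<lambda>J. measure M {\<omega>\<in>space M. cnt (U \<omega>) (outer z J n) \<noteq> 0}) \<longlonglongrightarrow> 0"
      unfolding EI E_def[symmetric] by simp
    fix J
    have "{\<omega>\<in>space M. cnt (U \<omega>) (outer z J n) \<noteq> 0} = space M - {\<omega>\<in>space M. cnt (U \<omega>) (outer z J n) = 0}" by auto
    thus "measure M {\<omega>\<in>space M. cnt (U \<omega>) (outer z J n) \<noteq> 0} = 1 - measure M {\<omega>\<in>space M. cnt (U \<omega>) (outer z J n) = 0}"
      by (simp only:) (rule prob_compl, measurable)
  qed
  show "antimono (\<lambda>J. measure (P k) {\<omega>\<in>space (P k). cnt (Ns k \<omega>) (outer z J n) \<noteq> 0})" if "k \<ge> 1" for k by (rule anti[OF pp(1)[OF that]])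
  show "(\<lambda>J. measure (P k) {\<omega>\<in>space (P k). cnt (Ns k \<omega>) (outer z J n) \<noteq> 0}) \<longlonglongrightarrow> 0" if "k \<ge> 1" for k by (rule lim[OF pp(1)[OF that]])
  show "(\<lambda>J. measure Q {\<omega>\<in>space Q. cnt (N \<omega>) (outer z J n) \<noteq> 0}) \<longlonglongrightarrow> 0" by (rule lim[OF pp(2)])
  fix J
  have "(\<lambda>k. 1 - measure (P k) {\<omega>\<in>space (P k). cnt (Ns k \<omega>) (outer z J n) = 0}) \<longlonglongrightarrow> measure Q {\<omega>\<in>space Q. cnt (N \<omega>) (outer z J n) \<noteq> 0}"
    unfolding eq[OF pp(2)] by (intro tendsto_intros cnt_conv outer_borel bounded_outer)
  thus "(\<lambda>k. measure (P k) {\<omega>\<in>space (P k). cnt (Ns k \<omega>) (outer z J n) \<noteq> 0}) \<longlonglongrightarrow> measure Q {\<omega>\<in>space Q. cnt (N \<omega>) (outer z J n) \<noteq> 0}"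
  proof (rule Lim_transform_eventually)
    show "\<forall>\<^sub>F k in sequentially. 1 - measure (P k) {\<omega>\<in>space (P k). cnt (Ns k \<omega>) (outer z J n) = 0} = measure (P k) {\<omega>\<in>space (P k). cnt (Ns k \<omega>) (outer z J n) \<noteq> 0}"
      using eventually_ge_at_top[of 1] by eventually_elim (rule eq[OF pp(1), symmetric])
  qed
qed

lemma tight:
  assumes e: "e > 0"
  shows "\<exists>M J. (\<forall>k\<ge>1. {\<omega>\<in>space (P k). Ns k \<omega> \<notin> tight_set z M J} \<in> sets (P k) \<and>
        measure (P k) {\<omega>\<in>space (P k). Ns k \<omega> \<notin> tight_set z M J} \<le> e) \<and>
    {\<omega>\<in>space Q. N \<omega> \<notin> tight_set z M J} \<in> sets Q \<and> measure Q {\<omega>\<in>space Q. N \<omega> \<notin> tight_set z M J} \<le> e"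
proof -
  \<comment> \<open>Two conditions for each radius \<open>n\<close>, each with probability of
    failure at most e / 2^(n + 2), add up to \<open>e\<close>.\<close>
  define d where "d n = e / 2 * (1 / 2) ^ Suc n" for n :: nat
  have d: "d n > 0" for n using e by (simp add: d_def)
  have "\<forall>n. \<exists>M. (\<forall>k\<ge>1. measure (P k) {\<omega>\<in>space (P k). cnt (Ns k \<omega>) (ball z (real n)) > M} \<le> d n) \<and>
    measure Q {\<omega>\<in>space Q. cnt (N \<omega>) (ball z (real n)) > M} \<le> d n"
    by (intro allI ball_tight d)
  then obtain M where M: "\<forall>n. (\<forall>k\<ge>1. measure (P k) {\<omega>\<in>space (P k). cnt (Ns k \<omega>) (ball z (real n)) > M n} \<le> d n) \<and>
    measure Q {\<omega>\<in>space Q. cnt (N \<omega>) (ball z (real n)) > M n} \<le> d n"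
    by (rule choice[THEN exE])
  have "\<forall>n. \<exists>J. (\<forall>k\<ge>1. measure (P k) {\<omega>\<in>space (P k). cnt (Ns k \<omega>) (outer z J n) \<noteq> 0} \<le> d n) \<and>
    measure Q {\<omega>\<in>space Q. cnt (N \<omega>) (outer z J n) \<noteq> 0} \<le> d n"
    by (intro allI outer_tight d)
  then obtain J where J: "\<forall>n. (\<forall>k\<ge>1. measure (P k) {\<omega>\<in>space (P k). cnt (Ns k \<omega>) (outer z (J n) n) \<noteq> 0} \<le> d n) \<and>
    measure Q {\<omega>\<in>space Q. cnt (N \<omega>) (outer z (J n) n) \<noteq> 0} \<le> d n"
    by (rule choice[THEN exE])
  have main: "{\<omega>\<in>space R. U \<omega> \<notin> tight_set z M J} \<in> sets R \<and> measure R {\<omega>\<in>space R. U \<omega> \<notin> tight_set z M J} \<le> e"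
    if U: "point_process R U" and MU: "\<And>n. measure R {\<omega>\<in>space R. cnt (U \<omega>) (ball z (real n)) > M n} \<le> d n"
      and JU: "\<And>n. measure R {\<omega>\<in>space R. cnt (U \<omega>) (outer z (J n) n) \<noteq> 0} \<le> d n"
    for R :: "'x measure" and U
  proof -
    interpret prob_space R using U by (simp add: point_process_def)
    define A where "A n = {\<omega>\<in>space R. cnt (U \<omega>) (ball z (real n)) > M n}" for n
    define B where "B n = {\<omega>\<in>space R. cnt (U \<omega>) (outer z (J n) n) \<noteq> 0}" for n
    have [measurable]: "(\<lambda>\<omega>. cnt (U \<omega>) (outer z (J n) n)) \<in> measurable R (count_space UNIV)"
      "(\<lambda>\<omega>. cnt (U \<omega>) (ball z (real n))) \<in> measurable R (count_space UNIV)" for n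
      by (intro measurable_cnt[OF U] outer_borel bounded_outer borel_open open_ball bounded_ball)+
    have AB: "A n \<in> sets R" "B n \<in> sets R" for n unfolding A_def B_def by measurable
    have eq: "{\<omega>\<in>space R. U \<omega> \<notin> tight_set z M J} = (\<Union>n. A n \<union> B n)"
      using U by (auto simp: tight_set_def A_def B_def point_process_def not_le)
    have le: "measure R (A n \<union> B n) \<le> e * (1 / 2) ^ Suc n" for n
    proof -
      have "measure R (A n \<union> B n) \<le> measure R (A n) + measure R (B n)" by (intro measure_Un_le AB)
      also have "\<dots> \<le> d n + d n" using MU[of n] JU[of n] unfolding A_def B_def by (rule add_mono)
      also have "\<dots> = e * (1 / 2) ^ Suc n" by (simp add: d_def)
      finally show ?thesis .
    qed
    have sums: "(\<lambda>n. e * (1 / 2) ^ Suc n) sums (e * 1)" by (intro sums_mult power_half_series)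
    have summ: "summable (\<lambda>n. measure R (A n \<union> B n))"
      by (rule summable_comparison_test'[OF sums_summable[OF sums], of 0]) (use le in auto)
    have "measure R (\<Union>n. A n \<union> B n) \<le> (\<Sum>n. measure R (A n \<union> B n))"
      using AB summ by (intro finite_measure_subadditive_countably) auto
    also have "\<dots> \<le> e * 1"
      using suminf_le[OF le summ sums_summable[OF sums]] unfolding sums_unique[OF sums] .
    finally show ?thesis unfolding eq using AB by auto
  qed
  have "{\<omega>\<in>space (P k). Ns k \<omega> \<notin> tight_set z M J} \<in> sets (P k) \<and> measure (P k) {\<omega>\<in>space (P k). Ns k \<omega> \<notin> tight_set z M J} \<le> e"
    if k: "k \<ge> 1" for k
    by (rule main[OF pp(1)[OF k] M[rule_format, THEN conjunct1, rule_format, OF k] J[rule_format, THEN conjunct1, rule_format, OF k]])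
  moreover have "{\<omega>\<in>space Q. N \<omega> \<notin> tight_set z M J} \<in> sets Q \<and> measure Q {\<omega>\<in>space Q. N \<omega> \<notin> tight_set z M J} \<le> e"
    by (rule main[OF pp(2) M[rule_format, THEN conjunct2] J[rule_format, THEN conjunct2]])
  ultimately show ?thesis by (intro exI[of _ M] exI[of _ J] conjI allI impI) simp_all
qed

text \<open>Here \<open>F\<close> enters as a bounded function of a random list of counts.\<close>

lemma disc_conv:
  fixes F :: "'a measure \<Rightarrow> real"
  assumes B: "\<And>\<xi>. \<bar>F \<xi>\<bar> \<le> B"
  shows "(\<lambda>k. \<integral>\<omega>. F (disc m (Ns k \<omega>)) \<partial>P k) \<longlonglongrightarrow> (\<integral>\<omega>. F (disc m (N \<omega>)) \<partial>Q)"
  unfolding disc_cell_counts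
proof (rule discrete_conv_integral[where G = "\<lambda>v. F (disc_of m (\<lambda>i. v ! i))", OF ps])
  fix s :: "nat list"
  show "(\<lambda>k. measure (P k) {\<omega>\<in>space (P k). cell_counts m (Ns k \<omega>) = s}) \<longlonglongrightarrow> measure Q {\<omega>\<in>space Q. cell_counts m (N \<omega>) = s}"
  \<comment> \<open>A list of any other length is never attained, and all the probabilities are
    0.\<close>
  proof (cases "length s = Suc m")
    case True
    have "disjoint_family_on (cell m :: nat \<Rightarrow> 'a set) {..<Suc m}"
      unfolding disjoint_family_on_def
    proof (intro ballI impI)
      fix i j assume "i \<in> {..<Suc m}" "j \<in> {..<Suc m}" "i \<noteq> j"
      thus "cell m i \<inter> (cell m j :: 'a set) = {}" using cell_unique[of _ m i j] by auto
    qed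
    moreover have "cell m i \<in> sets borel \<and> bounded (cell m i :: 'a set)" for i
      using cell_borel bounded_cell by blast
    ultimately show ?thesis
      unfolding cell_counts_eq_iff using True fidi_cnt[of "Suc m" "cell m" "\<lambda>i. s ! i"] by simp
  qed (simp add: cell_counts_eq_iff)
qed (use B pp in \<open>auto intro: measurable_cell_counts\<close>)

text \<open>The choices depend on each other in this order: the tolerance fixes the tight set, the
  tight set and \<open>F\<close> fix the level \<open>m\<close>, and only then does \<open>k\<close>
  tend to infinity.\<close>

lemma weak_conv: "pp_weak_conv P Ns Q N"
  unfolding pp_weak_conv_def
proof (intro allI impI, elim conjE)
  fix F :: "'a measure \<Rightarrow> real"
  assume F: "bounded (range F)" "wsharp_continuous F"
    and m1: "\<forall>k\<ge>1. (\<lambda>\<omega>. F (Ns k \<omega>)) \<in> borel_measurable (P k)" and m2: "(\<lambda>\<omega>. F (N \<omega>)) \<in> borel_measurable Q"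
  obtain B where B: "\<And>\<xi>. \<bar>F \<xi>\<bar> \<le> B" using F(1) by (auto simp: bounded_iff)
  have B0: "B \<ge> 0" using B[of undefined] by linarith
  show "(\<lambda>k. \<integral>\<omega>. F (Ns k \<omega>) \<partial>P k) \<longlonglongrightarrow> (\<integral>\<omega>. F (N \<omega>) \<partial>Q)"
  proof (rule tendsto_by_approximation)
    fix e :: real assume e: "e > 0"
    \<comment> \<open>The error \<open>e1\<close> on the tight set and the error
      \<open>2 * B * e1\<close> off it add up to exactly \<open>e\<close>.\<close>
    define e1 where "e1 = e / (2 * B + 1)"
    have "e1 * (2 * B + 1) = e" using B0 by (simp add: e1_def)
    moreover have "e1 + 2 * B * e1 = e1 * (2 * B + 1)" by (simp only: algebra_simps)
    moreover have "e1 > 0" using e B0 by (simp add: e1_def)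
    ultimately have e1: "e1 > 0" "e1 + 2 * B * e1 = e" by simp_all
    define z :: 'a where "z = undefined"
    obtain M J where T: "\<And>k. k \<ge> 1 \<Longrightarrow> {\<omega>\<in>space (P k). Ns k \<omega> \<notin> tight_set z M J} \<in> sets (P k)"
        "\<And>k. k \<ge> 1 \<Longrightarrow> measure (P k) {\<omega>\<in>space (P k). Ns k \<omega> \<notin> tight_set z M J} \<le> e1"
        "{\<omega>\<in>space Q. N \<omega> \<notin> tight_set z M J} \<in> sets Q" "measure Q {\<omega>\<in>space Q. N \<omega> \<notin> tight_set z M J} \<le> e1"
      using tight[OF e1(1), of z] by blast
    obtain m where m: "\<And>\<xi>. \<xi> \<in> tight_set z M J \<Longrightarrow> \<bar>F (disc m \<xi>) - F \<xi>\<bar> < e1"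
      using disc_uniform[OF F(2) e1(1), of z M J] by blast
    have app: "\<bar>(\<integral>\<omega>. F (U \<omega>) \<partial>R) - (\<integral>\<omega>. F (disc m (U \<omega>)) \<partial>R)\<bar> \<le> e"
      if U: "point_process R U" and Fm: "(\<lambda>\<omega>. F (U \<omega>)) \<in> borel_measurable R"
        and E: "{\<omega>\<in>space R. U \<omega> \<notin> tight_set z M J} \<in> sets R" "measure R {\<omega>\<in>space R. U \<omega> \<notin> tight_set z M J} \<le> e1"
      for R :: "'x measure" and U
    proof -
      have "prob_space R" using U by (simp add: point_process_def)
      moreover have "(\<lambda>\<omega>. F (disc m (U \<omega>))) \<in> borel_measurable R"
        unfolding disc_cell_counts by (rule measurable_compose[OF measurable_cell_counts[OF U]]) simp
      moreover have "\<bar>F (U \<omega>) - F (disc m (U \<omega>))\<bar> \<le> e1" if "\<omega> \<in> space R" "\<omega> \<notin> {\<omega>\<in>space R. U \<omega> \<notin> tight_set z M J}" for \<omega>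
        using m[of "U \<omega>"] that by (auto simp: abs_minus_commute)
      ultimately show ?thesis
        using integral_diff_le[OF _ Fm _ E(1) B B _ E(2), of "\<lambda>\<omega>. disc m (U \<omega>)" e1] e1 by simp
    qed
    show "\<exists>a l. a \<longlonglongrightarrow> l \<and> (\<forall>k\<ge>1. \<bar>(\<integral>\<omega>. F (Ns k \<omega>) \<partial>P k) - a k\<bar> \<le> e) \<and> \<bar>(\<integral>\<omega>. F (N \<omega>) \<partial>Q) - l\<bar> \<le> e"
      by (intro exI conjI allI impI, rule disc_conv[of F B m, OF B], rule app[OF pp(1) m1[rule_format] T(1,2)], assumption+,
          rule app[OF pp(2) m2 T(3,4)])
  qed
qed

end

section \<open>Application to the Waring and negative binomial processes\<close>

text \<open>For real \<open>z i\<close> in [-1, 1] each \<open>1 - z i\<close> is nonnegative, so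
  the base of the complex power is a nonnegative real, where complex and real powers agree;
  \<open>pgf_imp_nb_prob\<close> then applies.\<close>

lemma neg_binomial_process_fidi:
  fixes \<mu> :: "'a::polish_space measure"
  assumes nb: "neg_binomial_process Q N a c \<mu>" and c: "c > 0"
    and A: "\<And>i. i < l \<Longrightarrow> A i \<in> sets borel \<and> bounded (A i)" "disjoint_family_on A {..<l}"
  shows "measure Q {\<omega>\<in>space Q. \<forall>i<l. emeasure (N \<omega>) (A i) = of_nat (xs i)} = nb_prob a c l (\<lambda>i. measure \<mu> (A i)) xs"
proof -
  have pp: "point_process Q N" using nb by (simp add: neg_binomial_process_def)
  have "measure Q {\<omega>\<in>space Q. \<forall>i<l. cnt (N \<omega>) (A i) = xs i} = nb_prob a c l (\<lambda>i. measure \<mu> (A i)) xs"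
  proof (rule pgf_imp_nb_prob)
    show "prob_space Q" using pp by (simp add: point_process_def)
    show "(\<lambda>\<omega>. cnt (N \<omega>) (A i)) \<in> measurable Q (count_space UNIV)" if "i < l" for i
      using A(1)[OF that] by (intro measurable_cnt[OF pp]) auto
    fix z :: "nat \<Rightarrow> real" assume z: "\<And>i. i < l \<Longrightarrow> \<bar>z i\<bar> \<le> 1"
    define b where "b = 1 + 1 / c * (\<Sum>i<l. (1 - z i) * measure \<mu> (A i))"
    have "(\<Sum>i<l. (1 - z i) * measure \<mu> (A i)) \<ge> 0"
    proof (intro sum_nonneg mult_nonneg_nonneg measure_nonneg)
      show "0 \<le> 1 - z i" if "i \<in> {..<l}" for i using z[of i] that by auto
    qed
    hence b: "b \<ge> 0" using c by (simp add: b_def)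
    have "complex_of_real (\<integral>\<omega>. (\<Prod>i<l. z i ^ cnt (N \<omega>) (A i)) \<partial>Q) = (LINT \<omega>|Q. (\<Prod>i<l. complex_of_real (z i) ^ cnt (N \<omega>) (A i)))"
      by (subst integral_complex_of_real[symmetric]) simp
    also have "\<dots> = (1 + (1 / complex_of_real c) * (\<Sum>i<l. (1 - complex_of_real (z i)) * complex_of_real (measure \<mu> (A i)))) powr (- complex_of_real a)"
      using nb[unfolded neg_binomial_process_def, THEN conjunct2, rule_format, of l A "\<lambda>i. complex_of_real (z i)"] A z by simp
    also have "\<dots> = complex_of_real b powr complex_of_real (- a)" by (simp add: b_def)
    also have "\<dots> = complex_of_real (b powr (- a))" by (rule powr_of_real[OF b])
    finally show "(\<integral>\<omega>. (\<Prod>i<l. z i ^ cnt (N \<omega>) (A i)) \<partial>Q) = (1 + 1 / c * (\<Sum>i<l. (1 - z i) * measure \<mu> (A i))) powr (- a)"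
      unfolding b_def by (simp only: of_real_eq_iff)
  qed (use c in auto)
  also have "{\<omega>\<in>space Q. \<forall>i<l. cnt (N \<omega>) (A i) = xs i} = {\<omega>\<in>space Q. \<forall>i<l. emeasure (N \<omega>) (A i) = of_nat (xs i)}"
    using emeasure_eq_cnt_iff[OF pp] A(1) by auto
  finally show ?thesis .
qed

theorem theorem13:
  fixes \<mu> :: "'a::polish_space measure"
    and a c :: real
    and P :: "nat \<Rightarrow> 'w measure" and Ns :: "nat \<Rightarrow> 'w \<Rightarrow> 'a measure"
    and Q :: "'v measure" and N :: "'v \<Rightarrow> 'a measure"
  assumes sets_mu: "sets \<mu> = sets borel"
    and bfin: "\<forall>A\<in>sets borel. bounded A \<longrightarrow> emeasure \<mu> A < \<infinity>"
    and nonatomic: "\<forall>x. emeasure \<mu> {x} = 0"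
    and a_pos: "a > 0" and c_pos: "c > 0"
    and waring: "\<forall>k\<ge>1. gen_waring (P k) (Ns k) a (c * real k) (real k) \<mu>"
    and negbin: "neg_binomial_process Q N a c \<mu>"
  shows "pp_weak_conv P Ns Q N \<and>
    (\<forall>A\<in>sets borel. bounded A \<longrightarrow>
       (\<lambda>k. measure (P k) {\<omega>\<in>space (P k). emeasure (Ns k \<omega>) A = 0})
          \<longlonglongrightarrow> (c / (c + measure \<mu> A)) powr a \<and>
       measure Q {\<omega>\<in>space Q. emeasure (N \<omega>) A = 0} = (c / (c + measure \<mu> A)) powr a)"
proof -
  have Q: "measure Q {\<omega>\<in>space Q. \<forall>i<l. emeasure (N \<omega>) (A i) = of_nat (xs i)} = nb_prob a c l (\<lambda>i. measure \<mu> (A i)) xs"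
    and P: "(\<lambda>k. measure (P k) {\<omega>\<in>space (P k). \<forall>i<l. emeasure (Ns k \<omega>) (A i) = of_nat (xs i)})
        \<longlonglongrightarrow> nb_prob a c l (\<lambda>i. measure \<mu> (A i)) xs"
    if A: "\<And>i. i < l \<Longrightarrow> A i \<in> sets borel \<and> bounded (A i)" "disjoint_family_on A {..<l}" for l A xs
  proof -
    show "measure Q {\<omega>\<in>space Q. \<forall>i<l. emeasure (N \<omega>) (A i) = of_nat (xs i)} = nb_prob a c l (\<lambda>i. measure \<mu> (A i)) xs"
      by (rule neg_binomial_process_fidi[OF negbin c_pos A])
    show "(\<lambda>k. measure (P k) {\<omega>\<in>space (P k). \<forall>i<l. emeasure (Ns k \<omega>) (A i) = of_nat (xs i)})
        \<longlonglongrightarrow> nb_prob a c l (\<lambda>i. measure \<mu> (A i)) xs"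
    proof (rule Lim_transform_eventually[OF mgwd_tendsto[OF a_pos c_pos]])
      show "\<forall>\<^sub>F k in sequentially. mgwd a l (\<lambda>i. real k * measure \<mu> (A i)) (c * real k) xs
        = measure (P k) {\<omega>\<in>space (P k). \<forall>i<l. emeasure (Ns k \<omega>) (A i) = of_nat (xs i)}"
        using eventually_ge_at_top[of 1]
      proof eventually_elim
        case (elim k)
        with waring have "gen_waring (P k) (Ns k) a (c * real k) (real k) \<mu>" by simp
        with A show ?case unfolding gen_waring_def by simp
      qed
    qed simp
  qed
  interpret fidi_convergence P Ns Q N
  proof
    show "point_process (P k) (Ns k)" if "k \<ge> 1" for k using waring that by (simp add: gen_waring_def)
    show "point_process Q N" using negbin by (simp add: neg_binomial_process_def)
  qed (simp only: P Q)
  have void: "(\<lambda>k. measure (P k) {\<omega>\<in>space (P k). emeasure (Ns k \<omega>) A = 0}) \<longlonglongrightarrow> (c / (c + measure \<mu> A)) powr a"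
    "measure Q {\<omega>\<in>space Q. emeasure (N \<omega>) A = 0} = (c / (c + measure \<mu> A)) powr a"
    if A: "A \<in> sets borel" "bounded A" for A
  proof -
    \<comment> \<open>The void probability is the distribution for a family of one set, taken at
      count 0.\<close>
    have dis: "disjoint_family_on (\<lambda>_. A) {..<1::nat}" by (auto simp: disjoint_family_on_def)
    have "c + measure \<mu> A > 0" using c_pos by (simp add: add_pos_nonneg)
    hence "nb_prob a c 1 (\<lambda>_. measure \<mu> A) (\<lambda>_. 0) = (c / (c + measure \<mu> A)) powr a"
      using c_pos by (simp add: nb_prob_def powr_divide powr_minus_divide)
    moreover have "(\<lambda>k. measure (P k) {\<omega>\<in>space (P k). \<forall>i<1::nat. emeasure (Ns k \<omega>) A = of_nat 0}) \<longlonglongrightarrow> nb_prob a c 1 (\<lambda>_. measure \<mu> A) (\<lambda>_. 0)"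
      using P[of 1 "\<lambda>_. A" "\<lambda>_. 0", OF _ dis] A by simp
    moreover have "measure Q {\<omega>\<in>space Q. \<forall>i<1::nat. emeasure (N \<omega>) A = of_nat 0} = nb_prob a c 1 (\<lambda>_. measure \<mu> A) (\<lambda>_. 0)"
      using Q[of 1 "\<lambda>_. A" "\<lambda>_. 0", OF _ dis] A by simp
    ultimately show "(\<lambda>k. measure (P k) {\<omega>\<in>space (P k). emeasure (Ns k \<omega>) A = 0}) \<longlonglongrightarrow> (c / (c + measure \<mu> A)) powr a"
      "measure Q {\<omega>\<in>space Q. emeasure (N \<omega>) A = 0} = (c / (c + measure \<mu> A)) powr a"
      by (simp_all add: less_Suc_eq)
  qed
  show ?thesis by (intro conjI weak_conv ballI impI void)
qed

end
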